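(* Let $G$ be the Cayley graph of the lamplighter group $G_1=\mathbb{Z}\ltimes\bigoplus_{\mathbb{Z}}\mathbb{Z}_2$ with respect to the generators $(0,\{0\})$, $(1,\emptyset)$, $(-1,\emptyset)$, and let $G^+$ be the subgraph of $G$ induced by the vertex set $$\{(j,F): j\ge 0,\ \forall k\in F:\ k\ge 0\}.$$ Then percolation on $G^+$ with parameter $p=p_c(G^+)$ almost surely has no infinite clusters.
   Context: Lamplighter group. Elements of $G_1$ are pairs $(j,F)$ with $j\in\mathbb{Z}$ (the position of the lamplighter) and $F$ a finite subset of $\mathbb{Z}$ (the set of lit lamps). The group operation is $(j,F)\cdot(j',F')=(j+j',\,F\mathbin{\triangle}(j+F'))$, where $\triangle$ is symmetric difference and $j+F'=\{j+k:k\in F'\}$. The Cayley graph $G$ has vertex set $G_1$ and joins $g$ to $gs$ for every generator $s$: multiplying by $(0,\{0\})$ flips the lamp at the current position, and multiplying by $(\pm1,\emptyset)$ moves the lamplighter one step. Percolation. For a connected, locally finite infinite graph $H=(V,E)$ and $0\le p\le 1$, percolation on $H$ with parameter $p$ is the random subset of $E(H)$ (the open edges) in which each edge is open independently with probability $p$; its law is $\mathbb{P}_p$. The cluster of a vertex is the set of vertices joined to it by a path of open edges. $p_c(H)=\inf\{p: \mathbb{P}_p(\text{there is an infinite cluster})=1\}$. *)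

theory Defs
  imports "HOL-Algebra.Group" "HOL-Probability.Probability"
begin

section \<open>The lamplighter group\<close>

definition lamplighter_group :: "(int \<times> int set) monoid" where
  "lamplighter_group =
    \<lparr> carrier = {(j, F). finite F},
      monoid.mult = (\<lambda>(j, F) (j', F'). (j + j', sym_diff F ((\<lambda>k. j + k) ` F'))),
      monoid.one = (0, {}) \<rparr>"

definition lamplighter_generators :: "(int \<times> int set) set" where
  "lamplighter_generators = {(0, {0}), (1, {}), (-1, {})}"


section \<open>Undirected graphs and Cayley graphs\<close>

text \<open>A graph is a pair of a vertex set and a set of edges; an edge is the set of its endpoints.\<close>

type_synonym 'a ugraph = "'a set \<times> 'a set set"

abbreviation verts :: "'a ugraph \<Rightarrow> 'a set" where "verts H \<equiv> fst H"
abbreviation edges :: "'a ugraph \<Rightarrow> 'a set set" where "edges H \<equiv> snd H"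

definition cayley_graph :: "('a, 'b) monoid_scheme \<Rightarrow> 'a set \<Rightarrow> 'a ugraph" where
  "cayley_graph G S =
    (carrier G, {{g, g \<otimes>\<^bsub>G\<^esub> s} | g s. g \<in> carrier G \<and> s \<in> S})"

definition induced_subgraph :: "'a ugraph \<Rightarrow> 'a set \<Rightarrow> 'a ugraph" where
  "induced_subgraph H W = (verts H \<inter> W, {e \<in> edges H. e \<subseteq> W})"

definition lamplighter_graph :: "(int \<times> int set) ugraph" where
  "lamplighter_graph = cayley_graph lamplighter_group lamplighter_generators"

definition lamplighter_graph_plus :: "(int \<times> int set) ugraph" where
  "lamplighter_graph_plus =
    induced_subgraph lamplighter_graph {(j, F). j \<ge> 0 \<and> (\<forall>k\<in>F. k \<ge> 0)}"


section \<open>Bernoulli bond percolation\<close>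

text \<open>
  The law of the random set of open edges is represented on indicator functions: under the
  product measure, \<open>\<omega> e\<close> says that the edge \<open>e\<close> is open.
\<close>

definition percolation :: "'a ugraph \<Rightarrow> real \<Rightarrow> ('a set \<Rightarrow> bool) measure" where
  "percolation H p = PiM (edges H) (\<lambda>_. measure_pmf (bernoulli_pmf p))"

definition open_edges :: "'a ugraph \<Rightarrow> ('a set \<Rightarrow> bool) \<Rightarrow> 'a set set" where
  "open_edges H \<omega> = {e \<in> edges H. \<omega> e}"

definition cluster :: "'a ugraph \<Rightarrow> ('a set \<Rightarrow> bool) \<Rightarrow> 'a \<Rightarrow> 'a set" where
  "cluster H \<omega> v = {u \<in> verts H. (v, u) \<in> {(x, y). {x, y} \<in> open_edges H \<omega>}\<^sup>*}"

definition has_infinite_cluster :: "'a ugraph \<Rightarrow> ('a set \<Rightarrow> bool) \<Rightarrow> bool" where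
  "has_infinite_cluster H \<omega> \<longleftrightarrow> (\<exists>v\<in>verts H. infinite (cluster H \<omega> v))"

definition critical_probability :: "'a ugraph \<Rightarrow> real" where
  "critical_probability H =
    Inf {p. 0 \<le> p \<and> p \<le> 1 \<and>
      measure (percolation H p)
        {\<omega> \<in> space (percolation H p). has_infinite_cluster H \<omega>} = 1}"

end

theory Submission
  imports Defs
begin

text \<open>
  Percolation from the origin is governed by a finite-volume quantity that is continuous in \<open>p\<close>, so
  it cannot start exactly at the critical value.
  
  Write the height of a vertex \<open>(j, F)\<close> as \<open>j\<close>, and let the front at height \<open>n\<close> be the random
  set of all \<open>F \<subseteq> {0..n}\<close> such that the origin is joined to \<open>(n, F)\<close> inside the finite set of
  vertices of height at most \<open>n\<close> with lit lamps in \<open>{0..n}\<close>. The only edges leaving that set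
  lead up from \<open>(n, F)\<close> to \<open>(n + 1, F)\<close>, and above \<open>(n, F)\<close> lies a copy of the whole graph in
  which the lamps \<open>0, ..., n\<close> stay frozen. These copies are disjoint for different \<open>F\<close>.
  
  If the mean size \<open>m\<close> of some front satisfies \<open>p * m > 1\<close>, then the cluster of the origin
  contains a supercritical branching process and is infinite with positive probability
  (\<open>branching_bound\<close>, \<open>reach_prob_bounded_below\<close>); since the graph contains two disjoint copies
  of itself, an infinite cluster then exists almost surely (\<open>zero_one_law\<close>).
  
  Conversely, if there is an infinite cluster with positive probability, then by insertion
  tolerance the cluster of the origin is infinite with positive probability
  (\<open>infinite_cluster_at_origin\<close>). Its fronts cannot stay bounded, because a small front has a
  fixed chance of being cut off, so \<open>p * m > 1\<close> for some \<open>n\<close> (\<open>dying_bound\<close>,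
  \<open>large_front\<close>). For that \<open>n\<close>, the left-hand side is a polynomial in \<open>p\<close>, hence still
  exceeds 1 at some smaller parameter (\<open>smaller_parameter\<close>). So percolation at \<open>p\<close> implies
  percolation strictly below \<open>p\<close> (\<open>percolation_open\<close>), which is impossible at the infimum.
\<close>

section \<open>Events of Bernoulli percolation\<close>

abbreviation perc_prob :: "'a ugraph \<Rightarrow> real \<Rightarrow> (('a set \<Rightarrow> bool) \<Rightarrow> bool) \<Rightarrow> real" where
  "perc_prob H p P \<equiv> measure (percolation H p) {\<omega> \<in> space (percolation H p). P \<omega>}"

text \<open>
  A function of the configuration depends only on the edges in \<open>K\<close>. Configurations are
  compared as total functions, so no measurability and no extensionality is involved.
\<close>

definition depends_on :: "(('e \<Rightarrow> bool) \<Rightarrow> 'b) \<Rightarrow> 'e set \<Rightarrow> bool" where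
  "depends_on f K \<longleftrightarrow> (\<forall>\<omega> \<omega>'. (\<forall>e\<in>K. \<omega> e = \<omega>' e) \<longrightarrow> f \<omega> = f \<omega>')"

lemma depends_onI: "(\<And>\<omega> \<omega>'. (\<And>e. e \<in> K \<Longrightarrow> \<omega> e = \<omega>' e) \<Longrightarrow> f \<omega> = f \<omega>') \<Longrightarrow> depends_on f K"
  unfolding depends_on_def by blast

lemma depends_onD: "depends_on f K \<Longrightarrow> (\<And>e. e \<in> K \<Longrightarrow> \<omega> e = \<omega>' e) \<Longrightarrow> f \<omega> = f \<omega>'"
  unfolding depends_on_def by blast

lemma depends_on_comp: "depends_on f K \<Longrightarrow> depends_on (\<lambda>\<omega>. g (f \<omega>)) K"
  by (rule depends_onI, rule arg_cong[where f=g], rule depends_onD)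

lemma depends_on_mono: "depends_on f K \<Longrightarrow> K \<subseteq> K' \<Longrightarrow> depends_on f K'"
  unfolding depends_on_def by blast

lemma pred_countable_Bex:
  assumes "countable X" "\<And>i. i \<in> X \<Longrightarrow> Measurable.pred M (P i)"
  shows "Measurable.pred M (\<lambda>x. \<exists>i\<in>X. P i x)"
proof -
  have "{x \<in> space M. \<exists>i\<in>X. P i x} = (\<Union>i\<in>X. {x \<in> space M. P i x})" by auto
  also have "\<dots> \<in> sets M" using assms by (intro sets.countable_UN'') (auto simp: pred_def)
  finally show ?thesis by (simp add: pred_def)
qed

lemma pred_countable_Ball:
  assumes "countable X" "\<And>i. i \<in> X \<Longrightarrow> Measurable.pred M (P i)"
  shows "Measurable.pred M (\<lambda>x. \<forall>i\<in>X. P i x)"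
proof -
  have "Measurable.pred M (\<lambda>x. \<not> (\<exists>i\<in>X. \<not> P i x))"
    using assms by (intro pred_intros_logic(2) pred_countable_Bex)
  then show ?thesis by simp
qed

lemma prob_space_percolation: "prob_space (percolation H p)"
  unfolding percolation_def by (intro prob_space_PiM prob_space_measure_pmf)

lemma pred_edge_open: "e \<in> edges H \<Longrightarrow> Measurable.pred (percolation H p) (\<lambda>\<omega>. \<omega> e)"
proof -
  assume e: "e \<in> edges H"
  have "(\<lambda>\<omega>. \<omega> e) \<in> measurable (percolation H p) (measure_pmf (bernoulli_pmf p))"
    unfolding percolation_def using e by (rule measurable_component_singleton)
  then show ?thesis by simp
qed

lemma measurable_into_percolation:
  assumes "\<And>e. e \<in> edges H \<Longrightarrow> Measurable.pred M (\<lambda>x. g x e)"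
    and "\<And>x. x \<in> space M \<Longrightarrow> g x \<in> extensional (edges H)"
  shows "g \<in> measurable M (percolation H p)"
proof -
  have 1: "(\<lambda>x. \<lambda>e\<in>edges H. g x e) \<in> measurable M (percolation H p)"
    unfolding percolation_def using assms(1) by (intro measurable_restrict) simp
  have "g x = (\<lambda>e\<in>edges H. g x e)" if "x \<in> space M" for x
    using extensional_restrict[OF assms(2)[OF that]] by simp
  then show ?thesis using 1 by (simp cong: measurable_cong)
qed

lemma space_percolation: "space (percolation H p) = (edges H \<rightarrow>\<^sub>E UNIV)"
  by (simp add: percolation_def space_PiM)

text \<open>
  Events that depend on disjoint sets of edges are independent.
\<close>

lemma perc_prob_indep:
  assumes ne: "edges H \<noteq> {}" and L: "finite L" "L \<noteq> {}"
    and K: "\<And>l. l \<in> L \<Longrightarrow> K l \<subseteq> edges H" "disjoint_family_on K L"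
    and P: "\<And>l. l \<in> L \<Longrightarrow> Measurable.pred (percolation H p) (P l)"
    and dep: "\<And>l. l \<in> L \<Longrightarrow> depends_on (P l) (K l)"
  shows "perc_prob H p (\<lambda>\<omega>. \<forall>l\<in>L. P l \<omega>) = (\<Prod>l\<in>L. perc_prob H p (P l))"
proof -
  let ?M = "percolation H p"
  let ?N = "\<lambda>_. measure_pmf (bernoulli_pmf p)"
  interpret M: prob_space ?M by (rule prob_space_percolation)
  have "M.indep_vars ?N (\<lambda>e \<omega>. \<omega> e) (edges H)"
  proof (subst M.indep_vars_iff_distr_eq_PiM'[OF ne])
    show "(\<lambda>\<omega>. \<omega> e) \<in> measurable ?M (?N e)" if "e \<in> edges H" for e
      unfolding percolation_def using that by (rule measurable_component_singleton)
    have "distr ?M (PiM (edges H) ?N) (\<lambda>x. \<lambda>i\<in>edges H. x i) = distr ?M ?M (\<lambda>x. x)"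
      by (rule distr_cong) (auto simp: percolation_def space_PiM)
    also have "\<dots> = ?M" by simp
    also have "?M = PiM (edges H) (\<lambda>i. distr ?M (?N i) (\<lambda>x. x i))"
      unfolding percolation_def
      by (rule PiM_cong) (auto intro!: distr_PiM_component[symmetric] prob_space_measure_pmf)
    finally show "distr ?M (PiM (edges H) ?N) (\<lambda>x. \<lambda>i\<in>edges H. x i) =
      PiM (edges H) (\<lambda>i. distr ?M (?N i) (\<lambda>x. x i))" .
  qed
  from M.indep_vars_restrict[OF this K]
  have ind: "M.indep_vars (\<lambda>l. PiM (K l) ?N) (\<lambda>l \<omega>. restrict \<omega> (K l)) L" by simp
  define ext where "ext l \<eta> = (\<lambda>e\<in>edges H. e \<in> K l \<and> \<eta> e)" for l and \<eta> :: "'a set \<Rightarrow> bool"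
  define A where "A l = {\<eta> \<in> space (PiM (K l) ?N). P l (ext l \<eta>)}" for l
  have m: "ext l \<in> measurable (PiM (K l) ?N) ?M" if "l \<in> L" for l
  proof (rule measurable_into_percolation)
    fix e assume "e \<in> edges H"
    have "Measurable.pred (PiM (K l) ?N) (\<lambda>x. e \<in> K l \<and> x e)"
    proof (cases "e \<in> K l")
      case True
      then have "(\<lambda>x. x e) \<in> measurable (PiM (K l) ?N) (measure_pmf (bernoulli_pmf p))"
        by (rule measurable_component_singleton)
      with True show ?thesis by simp
    qed simp
    then show "Measurable.pred (PiM (K l) ?N) (\<lambda>x. ext l x e)"
      using \<open>e \<in> edges H\<close> by (simp add: ext_def)
  qed (simp add: ext_def)
  have "Measurable.pred (PiM (K l) ?N) (\<lambda>\<eta>. P l (ext l \<eta>))" if "l \<in> L" for l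
    by (rule measurable_compose[OF m[OF that] P[OF that]])
  then have A: "A l \<in> sets (PiM (K l) ?N)" if "l \<in> L" for l
    using that by (simp add: A_def pred_def)
  have eq: "(\<lambda>\<omega>. restrict \<omega> (K l)) -` A l \<inter> space ?M = {\<omega> \<in> space ?M. P l \<omega>}" if "l \<in> L" for l
  proof -
    have "P l (ext l (restrict \<omega> (K l))) = P l \<omega>" for \<omega>
      by (rule depends_onD[OF dep[OF that]]) (use K(1)[OF that] in \<open>auto simp: ext_def\<close>)
    then show ?thesis
      unfolding A_def space_PiM by auto
  qed
  have "M.prob (\<Inter>l\<in>L. (\<lambda>\<omega>. restrict \<omega> (K l)) -` A l \<inter> space ?M) =
        (\<Prod>l\<in>L. M.prob ((\<lambda>\<omega>. restrict \<omega> (K l)) -` A l \<inter> space ?M))"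
    by (rule M.indep_varsD_finite[OF ind]) (use L A in auto)
  moreover have "(\<Inter>l\<in>L. (\<lambda>\<omega>. restrict \<omega> (K l)) -` A l \<inter> space ?M) =
      {\<omega> \<in> space ?M. \<forall>l\<in>L. P l \<omega>}"
    using L(2) by (subst INF_cong[OF refl eq]) auto
  ultimately show ?thesis by (simp add: eq)
qed

lemma perc_prob_indep2:
  assumes ne: "edges H \<noteq> {}" and K: "J \<subseteq> edges H" "K \<subseteq> edges H" "J \<inter> K = {}"
    and P: "Measurable.pred (percolation H p) P" "depends_on P J"
    and Q: "Measurable.pred (percolation H p) Q" "depends_on Q K"
  shows "perc_prob H p (\<lambda>\<omega>. P \<omega> \<and> Q \<omega>) = perc_prob H p P * perc_prob H p Q"
proof -
  have "perc_prob H p (\<lambda>\<omega>. \<forall>l\<in>{True, False}. (case l of True \<Rightarrow> P | False \<Rightarrow> Q) \<omega>) =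
      (\<Prod>l\<in>{True, False}. perc_prob H p (case l of True \<Rightarrow> P | False \<Rightarrow> Q))"
    by (rule perc_prob_indep[OF ne, where K="case_bool J K"])
      (use K P Q in \<open>auto simp: disjoint_family_on_def split: bool.split\<close>)
  then show ?thesis by (simp add: ex_bool_eq)
qed

lemma perc_prob_indep_insert:
  assumes ne: "edges H \<noteq> {}" and L: "finite L"
    and J: "J \<subseteq> edges H" and K: "\<And>l. l \<in> L \<Longrightarrow> K l \<subseteq> edges H" "disjoint_family_on K L"
    and JK: "\<And>l. l \<in> L \<Longrightarrow> J \<inter> K l = {}"
    and Q: "Measurable.pred (percolation H p) Q" "depends_on Q J"
    and P: "\<And>l. l \<in> L \<Longrightarrow> Measurable.pred (percolation H p) (P l)"
    and dep: "\<And>l. l \<in> L \<Longrightarrow> depends_on (P l) (K l)"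
  shows "perc_prob H p (\<lambda>\<omega>. Q \<omega> \<and> (\<forall>l\<in>L. P l \<omega>)) = perc_prob H p Q * (\<Prod>l\<in>L. perc_prob H p (P l))"
proof -
  have "perc_prob H p (\<lambda>\<omega>. \<forall>l\<in>insert None (Some ` L). (case l of None \<Rightarrow> Q | Some l \<Rightarrow> P l) \<omega>) =
      (\<Prod>l\<in>insert None (Some ` L). perc_prob H p (case l of None \<Rightarrow> Q | Some l \<Rightarrow> P l))"
    by (rule perc_prob_indep[OF ne, where K="case_option J K"])
      (use L J K(1)[THEN subsetD] K(2) JK[unfolded disjoint_iff] Q P dep in
        \<open>auto simp: disjoint_family_on_def\<close>)
  then show ?thesis using L by (simp add: prod.reindex)
qed

text \<open>
  Reading a configuration through an injective map of edges gives percolation again; this is how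
  self-similarity of a graph becomes an identity between probabilities.
\<close>

lemma perc_prob_reindex:
  assumes f: "inj_on f (edges H)" "f \<in> edges H \<rightarrow> edges H'"
    and P: "Measurable.pred (percolation H p) P"
  shows "Measurable.pred (percolation H' p) (\<lambda>\<omega>. P (\<lambda>e\<in>edges H. \<omega> (f e)))"
    and "perc_prob H' p (\<lambda>\<omega>. P (\<lambda>e\<in>edges H. \<omega> (f e))) = perc_prob H p P"
proof -
  let ?t = "\<lambda>\<omega>. \<lambda>e\<in>edges H. \<omega> (f e)"
  have t: "?t \<in> measurable (percolation H' p) (percolation H p)"
    by (rule measurable_into_percolation) (use f(2) in \<open>auto simp: Pi_iff intro!: pred_edge_open\<close>)
  show "Measurable.pred (percolation H' p) (\<lambda>\<omega>. P (?t \<omega>))"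
    by (rule measurable_compose[OF t P])
  have "distr (percolation H' p) (percolation H p) ?t = percolation H p"
    unfolding percolation_def
    by (rule distr_PiM_reindex) (use f in \<open>auto intro: prob_space_measure_pmf\<close>)
  then have "perc_prob H p P = measure (distr (percolation H' p) (percolation H p) ?t)
      {\<omega> \<in> space (percolation H p). P \<omega>}" by simp
  also have "\<dots> = measure (percolation H' p) (?t -` {\<omega> \<in> space (percolation H p). P \<omega>} \<inter> space (percolation H' p))"
    by (rule measure_distr[OF t]) (use P in \<open>simp add: pred_def\<close>)
  also have "?t -` {\<omega> \<in> space (percolation H p). P \<omega>} \<inter> space (percolation H' p) =
      {\<omega> \<in> space (percolation H' p). P (?t \<omega>)}"
    using measurable_space[OF t] by auto
  finally show "perc_prob H' p (\<lambda>\<omega>. P (?t \<omega>)) = perc_prob H p P" ..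
qed

text \<open>
  The probability of an event that depends on finitely many edges is a polynomial
  in \<open>p\<close>.
\<close>

lemma perc_prob_finite_support:
  assumes K: "finite K" "K \<subseteq> edges H" and dep: "depends_on P K" and p: "0 \<le> p" "p \<le> 1"
  shows "perc_prob H p P = (\<Sum>\<eta>\<in>{\<eta> \<in> K \<rightarrow>\<^sub>E UNIV. P \<eta>}. \<Prod>e\<in>K. if \<eta> e then p else 1 - p)"
proof -
  let ?M = "percolation H p"
  let ?N = "\<lambda>_. measure_pmf (bernoulli_pmf p)"
  let ?C = "\<lambda>\<eta>. {\<omega> \<in> space ?M. \<forall>e\<in>K. \<omega> e = \<eta> e}"
  interpret N: product_prob_space ?N "edges H" by unfold_locales
  interpret M: prob_space ?M by (rule prob_space_percolation)
  have sC: "?C \<eta> \<in> sets ?M" for \<eta>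
  proof -
    have "Measurable.pred ?M (\<lambda>\<omega>. \<omega> e = \<eta> e)" if "e \<in> K" for e
      using pred_edge_open[of e H p] K(2) that by (cases "\<eta> e") auto
    then have "Measurable.pred ?M (\<lambda>\<omega>. \<forall>e\<in>K. \<omega> e = \<eta> e)"
      using K(1) by (intro pred_intros_finite(3))
    then show ?thesis by (simp add: pred_def)
  qed
  have mC: "measure ?M (?C \<eta>) = (\<Prod>e\<in>K. if \<eta> e then p else 1 - p)" for \<eta>
  proof -
    have "emeasure ?M {\<omega> \<in> space ?M. \<forall>e\<in>K. \<omega> e \<in> {\<eta> e}} =
        (\<Prod>e\<in>K. emeasure (measure_pmf (bernoulli_pmf p)) {\<eta> e})"
      unfolding percolation_def using K by (intro N.emeasure_PiM_Collect) auto
    also have "\<dots> = (\<Prod>e\<in>K. ennreal (if \<eta> e then p else 1 - p))"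
      using p by (intro prod.cong) (auto simp: emeasure_pmf_single)
    also have "\<dots> = ennreal (\<Prod>e\<in>K. if \<eta> e then p else 1 - p)"
      using p by (intro prod_ennreal) auto
    finally show ?thesis
      using p by (simp add: measure_def prod_nonneg)
  qed
  have "{\<omega> \<in> space ?M. P \<omega>} = (\<Union>\<eta>\<in>{\<eta> \<in> K \<rightarrow>\<^sub>E UNIV. P \<eta>}. ?C \<eta>)"
  proof (intro equalityI subsetI)
    fix \<omega> assume "\<omega> \<in> {\<omega> \<in> space ?M. P \<omega>}"
    moreover have "P (restrict \<omega> K) = P \<omega>" by (rule depends_onD[OF dep]) simp
    ultimately show "\<omega> \<in> (\<Union>\<eta>\<in>{\<eta> \<in> K \<rightarrow>\<^sub>E UNIV. P \<eta>}. ?C \<eta>)"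
      by (intro UN_I[of "restrict \<omega> K"]) auto
  next
    fix \<omega> assume "\<omega> \<in> (\<Union>\<eta>\<in>{\<eta> \<in> K \<rightarrow>\<^sub>E UNIV. P \<eta>}. ?C \<eta>)"
    then obtain \<eta> where "P \<eta>" "\<omega> \<in> ?C \<eta>" by auto
    moreover from this have "P \<omega> = P \<eta>" by (intro depends_onD[OF dep]) auto
    ultimately show "\<omega> \<in> {\<omega> \<in> space ?M. P \<omega>}" by auto
  qed
  moreover have "measure ?M (\<Union>\<eta>\<in>{\<eta> \<in> K \<rightarrow>\<^sub>E UNIV. P \<eta>}. ?C \<eta>) =
      (\<Sum>\<eta>\<in>{\<eta> \<in> K \<rightarrow>\<^sub>E UNIV. P \<eta>}. measure ?M (?C \<eta>))"
  proof (rule M.finite_measure_finite_Union)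
    show "finite {\<eta> \<in> K \<rightarrow>\<^sub>E (UNIV :: bool set). P \<eta>}"
      using K(1) by (simp add: finite_PiE)
    show "?C ` {\<eta> \<in> K \<rightarrow>\<^sub>E UNIV. P \<eta>} \<subseteq> M.events" using sC by auto
    show "disjoint_family_on ?C {\<eta> \<in> K \<rightarrow>\<^sub>E UNIV. P \<eta>}"
    proof (unfold disjoint_family_on_def, intro ballI impI)
      fix \<eta> \<eta>' assume *: "\<eta> \<in> {\<eta> \<in> K \<rightarrow>\<^sub>E UNIV. P \<eta>}" "\<eta>' \<in> {\<eta> \<in> K \<rightarrow>\<^sub>E UNIV. P \<eta>}" "\<eta> \<noteq> \<eta>'"
      have "\<exists>e\<in>K. \<eta> e \<noteq> \<eta>' e"
      proof (rule ccontr)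
        assume "\<not> (\<exists>e\<in>K. \<eta> e \<noteq> \<eta>' e)"
        with * have "\<eta> = \<eta>'" by (intro PiE_ext[of \<eta> K "\<lambda>_. UNIV"]) auto
        with * show False by simp
      qed
      then show "?C \<eta> \<inter> ?C \<eta>' = {}" by auto
    qed
  qed
  ultimately show ?thesis by (simp add: mC)
qed

lemma perc_prob_edge_open:
  assumes "e \<in> edges H" "0 \<le> p" "p \<le> 1"
  shows "perc_prob H p (\<lambda>\<omega>. \<omega> e) = p"
proof -
  interpret N: product_prob_space "\<lambda>_. measure_pmf (bernoulli_pmf p)" "edges H" by unfold_locales
  have "emeasure (percolation H p) {\<omega> \<in> space (percolation H p). \<omega> e \<in> {True}} =
      emeasure (measure_pmf (bernoulli_pmf p)) {True}"
    unfolding percolation_def using assms(1) by (intro N.emeasure_PiM_Collect_single) auto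
  then show ?thesis
    using assms by (simp add: measure_def emeasure_pmf_single)
qed

text \<open>
  Insertion tolerance: forcing one edge open keeps an increasing event possible. The event
  \<open>P\<close> after opening \<open>e\<close> no longer depends on \<open>e\<close>.
\<close>

lemma perc_prob_insert_edge:
  assumes e: "e \<in> edges H" and p: "0 \<le> p" "p \<le> 1"
    and P: "Measurable.pred (percolation H p) P" "depends_on P (edges H)"
    and inc: "\<And>\<omega>. P \<omega> \<Longrightarrow> P (fun_upd \<omega> e True)"
  shows "p * perc_prob H p P \<le> perc_prob H p (\<lambda>\<omega>. \<omega> e \<and> P \<omega>)"
proof -
  let ?M = "percolation H p"
  interpret M: prob_space ?M by (rule prob_space_percolation)
  have upd: "(\<lambda>\<omega>. fun_upd \<omega> e True) \<in> measurable ?M ?M"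
  proof (rule measurable_into_percolation)
    show "Measurable.pred ?M (\<lambda>x. (x(e := True)) e')" if "e' \<in> edges H" for e'
      using pred_edge_open[OF that] by simp
    show "x(e := True) \<in> extensional (edges H)" if "x \<in> space ?M" for x
      using that e by (auto simp: space_percolation PiE_iff extensional_def)
  qed
  have mP: "Measurable.pred ?M (\<lambda>\<omega>. P (fun_upd \<omega> e True))"
    by (rule measurable_compose[OF upd P(1)])
  have "p * perc_prob H p P \<le> p * perc_prob H p (\<lambda>\<omega>. P (fun_upd \<omega> e True))"
    using p mP inc by (intro mult_left_mono M.finite_measure_mono) (auto simp: pred_def)
  also have "\<dots> = perc_prob H p (\<lambda>\<omega>. \<omega> e) * perc_prob H p (\<lambda>\<omega>. P (fun_upd \<omega> e True))"
    using perc_prob_edge_open[OF e p] by simp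
  also have "\<dots> = perc_prob H p (\<lambda>\<omega>. \<omega> e \<and> P (fun_upd \<omega> e True))"
  proof (rule perc_prob_indep2[symmetric, where J="{e}" and K="edges H - {e}"])
    show "depends_on (\<lambda>\<omega>. P (fun_upd \<omega> e True)) (edges H - {e})"
      by (rule depends_onI, rule depends_onD[OF P(2)]) auto
  qed (use e mP in \<open>auto simp: depends_on_def intro: pred_edge_open\<close>)
  also have "\<dots> = perc_prob H p (\<lambda>\<omega>. \<omega> e \<and> P \<omega>)"
    by (rule arg_cong[where f="measure ?M"]) (auto simp: fun_upd_idem)
  finally show ?thesis .
qed

section \<open>Clusters\<close>

lemma cluster_subset_verts: "cluster H \<omega> v \<subseteq> verts H"
  by (auto simp: cluster_def)

lemma depends_on_cluster: "depends_on (\<lambda>\<omega>. cluster H \<omega> v) (edges H)"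
proof (rule depends_onI)
  fix \<omega> \<omega>' :: "'a set \<Rightarrow> bool" assume "\<And>e. e \<in> edges H \<Longrightarrow> \<omega> e = \<omega>' e"
  then have "open_edges H \<omega> = open_edges H \<omega>'" by (auto simp: open_edges_def)
  then show "cluster H \<omega> v = cluster H \<omega>' v" by (simp add: cluster_def)
qed

lemma cluster_mono:
  assumes "verts H' \<subseteq> verts H" "edges H' \<subseteq> edges H" "\<And>e. e \<in> edges H' \<Longrightarrow> \<omega> e \<Longrightarrow> \<omega>' e"
  shows "cluster H' \<omega> v \<subseteq> cluster H \<omega>' v"
proof -
  have "{(x, y). {x, y} \<in> open_edges H' \<omega>}\<^sup>* \<subseteq> {(x, y). {x, y} \<in> open_edges H \<omega>'}\<^sup>*"
    using assms by (intro rtrancl_mono) (auto simp: open_edges_def)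
  then show ?thesis using assms(1) by (auto simp: cluster_def)
qed

lemma cluster_refl: "v \<in> verts H \<Longrightarrow> v \<in> cluster H \<omega> v"
  by (simp add: cluster_def)

lemma cluster_step:
  "u \<in> cluster H \<omega> v \<Longrightarrow> {u, w} \<in> edges H \<Longrightarrow> \<omega> {u, w} \<Longrightarrow> w \<in> verts H \<Longrightarrow> w \<in> cluster H \<omega> v"
  by (auto simp: cluster_def open_edges_def intro: rtrancl_into_rtrancl)

lemma cluster_trans: "u \<in> cluster H \<omega> v \<Longrightarrow> w \<in> cluster H \<omega> u \<Longrightarrow> w \<in> cluster H \<omega> v"
  by (auto simp: cluster_def)

lemma pred_cluster:
  assumes V: "countable (verts H)" "edges H \<subseteq> Pow (verts H)" and sub: "edges H \<subseteq> edges G"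
  shows "Measurable.pred (percolation G p) (\<lambda>\<omega>. u \<in> cluster H \<omega> v)"
proof -
  let ?R = "\<lambda>\<omega>. {(x, y). {x, y} \<in> open_edges H \<omega>}"
  have edge: "Measurable.pred (percolation G p) (\<lambda>\<omega>. (w, u) \<in> ?R \<omega>)" for w u
  proof (cases "{w, u} \<in> edges H")
    case True
    then show ?thesis using sub by (auto simp: open_edges_def intro!: pred_edge_open)
  qed (simp add: open_edges_def)
  have "Measurable.pred (percolation G p) (\<lambda>\<omega>. (v, u) \<in> ?R \<omega> ^^ n)" for n
  proof (induction n arbitrary: u)
    case (Suc n)
    have "(v, u) \<in> ?R \<omega> ^^ Suc n \<longleftrightarrow> (\<exists>w\<in>verts H. (v, w) \<in> ?R \<omega> ^^ n \<and> (w, u) \<in> ?R \<omega>)" for \<omega>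
      using V(2) by (auto simp: open_edges_def relcomp_unfold)
    then show ?case
      by (simp only:) (intro pred_countable_Bex[OF V(1)] pred_intros_logic(3) Suc.IH edge)
  qed simp
  then show ?thesis
    unfolding cluster_def mem_Collect_eq rtrancl_is_UN_relpow UN_iff
    by (intro pred_intros_conj1' pred_countable_Bex) auto
qed

text \<open>
  Infinite means not contained in any of the countably many finite vertex sets.
\<close>

lemma pred_infinite_cluster:
  assumes V: "countable (verts H)" "edges H \<subseteq> Pow (verts H)"
  shows "Measurable.pred (percolation H p) (\<lambda>\<omega>. infinite (cluster H \<omega> v))"
proof -
  have "infinite (cluster H \<omega> v) \<longleftrightarrow>
      (\<forall>S\<in>{S. finite S \<and> S \<subseteq> verts H}. \<exists>u\<in>verts H. u \<in> cluster H \<omega> v \<and> u \<notin> S)" for \<omega>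
  proof
    assume "infinite (cluster H \<omega> v)"
    then show "\<forall>S\<in>{S. finite S \<and> S \<subseteq> verts H}. \<exists>u\<in>verts H. u \<in> cluster H \<omega> v \<and> u \<notin> S"
      using cluster_subset_verts[of H \<omega> v] by (metis (no_types, lifting) finite_subset mem_Collect_eq subset_iff)
  next
    assume *: "\<forall>S\<in>{S. finite S \<and> S \<subseteq> verts H}. \<exists>u\<in>verts H. u \<in> cluster H \<omega> v \<and> u \<notin> S"
    then show "infinite (cluster H \<omega> v)"
      using cluster_subset_verts[of H \<omega> v] by blast
  qed
  moreover have "countable {S. finite S \<and> S \<subseteq> verts H}"
    using countable_Collect_finite_subset[OF V(1)] by simp
  ultimately show ?thesis
    using V by (simp only:) (intro pred_countable_Bex pred_countable_Ball pred_intros_conj2' pred_cluster; simp)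
qed

lemma pred_has_infinite_cluster:
  assumes V: "countable (verts H)" "edges H \<subseteq> Pow (verts H)"
  shows "Measurable.pred (percolation H p) (has_infinite_cluster H)"
  unfolding has_infinite_cluster_def[abs_def]
  using assms by (intro pred_countable_Bex pred_infinite_cluster)

text \<open>
  A path that leaves \<open>W\<close> has a first edge leaving \<open>W\<close>; up to there it runs inside \<open>W\<close>.
\<close>

lemma cluster_exit:
  assumes v: "v \<in> W" "v \<in> verts H" and E: "edges H \<subseteq> Pow (verts H)"
    and u: "u \<in> cluster H \<omega> v" "u \<notin> W"
  shows "\<exists>x y. x \<in> cluster (induced_subgraph H W) \<omega> v \<and> y \<notin> W \<and> {x, y} \<in> edges H \<and> \<omega> {x, y}"
proof (rule ccontr)
  let ?R = "{(x, y). {x, y} \<in> open_edges H \<omega>}"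
  assume no: "\<not> ?thesis"
  from u(1) have "(v, u) \<in> ?R\<^sup>*" by (simp add: cluster_def)
  then have "u \<in> cluster (induced_subgraph H W) \<omega> v"
  proof induction
    case base
    show ?case using v by (intro cluster_refl) (simp add: induced_subgraph_def)
  next
    case (step y z)
    then have yz: "{y, z} \<in> edges H" "\<omega> {y, z}" by (auto simp: open_edges_def)
    then have "z \<in> W" using no step.IH by blast
    moreover have "y \<in> W"
      using step.IH cluster_subset_verts[of "induced_subgraph H W"] by (auto simp: induced_subgraph_def)
    ultimately show ?case
      using yz E by (intro cluster_step[OF step.IH]) (auto simp: induced_subgraph_def)
  qed
  then show False
    using u(2) cluster_subset_verts[of "induced_subgraph H W"] by (auto simp: induced_subgraph_def)
qed

text \<open>
  Graph homomorphisms map clusters of the pulled-back configuration into clusters.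
\<close>

lemma cluster_map:
  assumes V: "\<phi> ` verts H \<subseteq> verts H'" and E: "\<And>e. e \<in> edges H \<Longrightarrow> \<phi> ` e \<in> edges H'"
    and sub: "edges H \<subseteq> Pow (verts H)"
    and v: "v \<in> verts H" and u: "u \<in> cluster H (\<lambda>e\<in>edges H. \<omega> (\<phi> ` e)) v"
  shows "\<phi> u \<in> cluster H' \<omega> (\<phi> v)"
proof -
  have "(v, u) \<in> {(x, y). {x, y} \<in> open_edges H (\<lambda>e\<in>edges H. \<omega> (\<phi> ` e))}\<^sup>*"
    using u by (simp add: cluster_def)
  then show ?thesis
  proof induction
    case base
    show ?case using V v by (intro cluster_refl) auto
  next
    case (step y z)
    then have yz: "{y, z} \<in> edges H" "\<omega> (\<phi> ` {y, z})" by (auto simp: open_edges_def)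
    show ?case
      by (rule cluster_step[OF step.IH]) (use yz E[OF yz(1)] V sub in auto)
  qed
qed

section \<open>The half-lamplighter graph\<close>

abbreviation LG :: "(int \<times> int set) ugraph" where "LG \<equiv> lamplighter_graph_plus"

text \<open>
  The two kinds of edges: moving the lamplighter from \<open>j\<close> to \<open>j + 1\<close>, and flipping lamp \<open>j\<close>.
\<close>

definition up_edge :: "int \<Rightarrow> int set \<Rightarrow> (int \<times> int set) set" where
  "up_edge j F = {(j, F), (j + 1, F)}"

definition flip_edge :: "int \<Rightarrow> int set \<Rightarrow> (int \<times> int set) set" where
  "flip_edge j F = {(j, F), (j, sym_diff F {j})}"

lemma verts_LG: "verts LG = {(j, F). 0 \<le> j \<and> finite F \<and> (\<forall>k\<in>F. 0 \<le> k)}"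
  by (auto simp: lamplighter_graph_plus_def lamplighter_graph_def induced_subgraph_def
      cayley_graph_def lamplighter_group_def)

text \<open>
  The generator \<open>(-1, {})\<close> gives the same undirected edges as \<open>(1, {})\<close>, listed from
  the other end.
\<close>

lemma edges_lamplighter_graph:
  "e \<in> edges lamplighter_graph \<longleftrightarrow>
    (\<exists>j F. finite F \<and> (e = flip_edge j F \<or> e = up_edge j F \<or> e = up_edge (j - 1) F))"
proof -
  let ?G = lamplighter_group
  have "e \<in> edges lamplighter_graph \<longleftrightarrow> (\<exists>g\<in>carrier ?G.
      e = {g, g \<otimes>\<^bsub>?G\<^esub> (0, {0})} \<or> e = {g, g \<otimes>\<^bsub>?G\<^esub> (1, {})} \<or> e = {g, g \<otimes>\<^bsub>?G\<^esub> (-1, {})})"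
    unfolding lamplighter_graph_def cayley_graph_def lamplighter_generators_def snd_conv by blast
  also have "\<dots> \<longleftrightarrow> (\<exists>j F. finite F \<and>
      (e = {(j, F), (j, F) \<otimes>\<^bsub>?G\<^esub> (0, {0})} \<or> e = {(j, F), (j, F) \<otimes>\<^bsub>?G\<^esub> (1, {})} \<or>
       e = {(j, F), (j, F) \<otimes>\<^bsub>?G\<^esub> (-1, {})}))"
    by (simp add: lamplighter_group_def Bex_def split_paired_Ex)
  also have "\<dots> \<longleftrightarrow> (\<exists>j F. finite F \<and> (e = flip_edge j F \<or> e = up_edge j F \<or> e = up_edge (j - 1) F))"
    by (simp add: lamplighter_group_def flip_edge_def up_edge_def insert_commute)
  finally show ?thesis .
qed

lemma edges_LG:
  "e \<in> edges LG \<longleftrightarrow> (\<exists>j F. (j, F) \<in> verts LG \<and> (e = up_edge j F \<or> e = flip_edge j F))"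
proof
  let ?V = "{(j :: int, F :: int set). j \<ge> 0 \<and> (\<forall>k\<in>F. k \<ge> 0)}"
  assume "e \<in> edges LG"
  then have e: "e \<in> edges lamplighter_graph" "e \<subseteq> ?V"
    by (simp_all add: lamplighter_graph_plus_def induced_subgraph_def)
  then obtain j F where F: "finite F" and "e = flip_edge j F \<or> e = up_edge j F \<or> e = up_edge (j - 1) F"
    unfolding edges_lamplighter_graph by blast
  then show "\<exists>j F. (j, F) \<in> verts LG \<and> (e = up_edge j F \<or> e = flip_edge j F)"
  proof (elim disjE)
    assume "e = flip_edge j F"
    then show ?thesis using F e(2) by (intro exI[of _ j] exI[of _ F]) (simp add: verts_LG flip_edge_def)
  next
    assume "e = up_edge j F"
    then show ?thesis using F e(2) by (intro exI[of _ j] exI[of _ F]) (simp add: verts_LG up_edge_def)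
  next
    assume "e = up_edge (j - 1) F"
    then show ?thesis using F e(2) by (intro exI[of _ "j - 1"] exI[of _ F]) (simp add: verts_LG up_edge_def)
  qed
next
  assume "\<exists>j F. (j, F) \<in> verts LG \<and> (e = up_edge j F \<or> e = flip_edge j F)"
  then obtain j F where V: "(j, F) \<in> verts LG" and e: "e = up_edge j F \<or> e = flip_edge j F" by blast
  from V have "e \<subseteq> {(j, F). j \<ge> 0 \<and> (\<forall>k\<in>F. k \<ge> 0)}"
    using e by (auto simp: up_edge_def flip_edge_def verts_LG)
  moreover have "e \<in> edges lamplighter_graph"
    using V e unfolding edges_lamplighter_graph by (auto simp: verts_LG)
  ultimately show "e \<in> edges LG"
    by (simp add: lamplighter_graph_plus_def induced_subgraph_def)
qed

lemma up_edge_in: "(j, F) \<in> verts LG \<Longrightarrow> up_edge j F \<in> edges LG"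
  and flip_edge_in: "(j, F) \<in> verts LG \<Longrightarrow> flip_edge j F \<in> edges LG"
  by (auto simp: edges_LG)

lemma edges_LG_cases:
  assumes "e \<in> edges LG"
  obtains j F where "(j, F) \<in> verts LG" "e = up_edge j F" | j F where "(j, F) \<in> verts LG" "e = flip_edge j F"
  using assms edges_LG by blast

lemma edges_LG_subset: "edges LG \<subseteq> Pow (verts LG)"
proof
  fix e assume "e \<in> edges LG"
  then show "e \<in> Pow (verts LG)"
    by (cases rule: edges_LG_cases) (auto simp: up_edge_def flip_edge_def verts_LG)
qed

lemma countable_verts_LG: "countable (verts LG)"
proof -
  have "countable (UNIV \<times> {F :: int set. finite F} :: (int \<times> int set) set)"
    by (intro countable_SIGMA countable_Collect_finite) auto
  then show ?thesis
    by (rule countable_subset[rotated]) (auto simp: verts_LG)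
qed

definition origin :: "int \<times> int set" where "origin = (0, {})"

lemma origin_in: "origin \<in> verts LG" by (simp add: origin_def verts_LG)

lemma edges_LG_nonempty: "edges LG \<noteq> {}"
  using up_edge_in[of 0 "{}"] by (simp add: verts_LG) blast

lemma LG_connected:
  assumes "v \<in> verts LG"
  shows "(origin, v) \<in> {(x, y). {x, y} \<in> edges LG}\<^sup>*"
proof -
  let ?R = "{(x, y). {x, y} \<in> edges LG}"
  have sym: "sym (?R\<^sup>*)" by (intro sym_rtrancl) (auto simp: sym_def insert_commute)
  have vertical: "((0, F), (j, F)) \<in> ?R\<^sup>*" if F: "finite F" "\<forall>k\<in>F. 0 \<le> k" and "0 \<le> j" for j F
  proof -
    have "((0, F), (int n, F)) \<in> ?R\<^sup>*" for n
    proof (induction n)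
      case (Suc n)
      moreover have "((int n, F), (int (Suc n), F)) \<in> ?R"
        using up_edge_in[of "int n" F] F by (simp add: verts_LG up_edge_def add.commute)
      ultimately show ?case by (rule rtrancl_into_rtrancl)
    qed simp
    from this[of "nat j"] show ?thesis using \<open>0 \<le> j\<close> by simp
  qed
  have "(origin, (0, F)) \<in> ?R\<^sup>*" if "finite F" "\<forall>k\<in>F. 0 \<le> k" for F
    using that
  proof (induction F)
    case empty
    show ?case by (simp add: origin_def)
  next
    case (insert k F)
    have F: "finite F" "\<forall>i\<in>F. 0 \<le> i" "0 \<le> k" using insert by simp_all
    have "(origin, (0, F)) \<in> ?R\<^sup>*" by (rule insert.IH[OF F(2)])
    also have "((0, F), (k, F)) \<in> ?R\<^sup>*" by (rule vertical[OF F])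
    also have "((k, F), (k, insert k F)) \<in> ?R"
    proof -
      have "sym_diff F {k} = insert k F" using insert by auto
      then show ?thesis
        using flip_edge_in[of k F] F by (simp add: verts_LG flip_edge_def)
    qed
    also have "((k, insert k F), (0, insert k F)) \<in> ?R\<^sup>*"
      by (rule symD[OF sym vertical]) (use F in simp_all)
    finally show ?case .
  qed
  moreover obtain j F where "v = (j, F)" "0 \<le> j" "finite F" "\<forall>k\<in>F. 0 \<le> k"
    using assms by (auto simp: verts_LG)
  ultimately show ?thesis using vertical[of F j] rtrancl_trans[of origin "(0, F)" ?R v] by simp
qed

text \<open>
  The vertices at height at most \<open>n\<close> whose lit lamps lie in \<open>{0..n}\<close>, a finite set. Here the
  height of \<open>(j, F)\<close> is \<open>j\<close>. Flipping edges never leave the block, since a lamplighter at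
  height at most \<open>n\<close> can only flip lamps of the block.
\<close>

definition block :: "nat \<Rightarrow> (int \<times> int set) set" where
  "block n = {0..int n} \<times> Pow {0..int n}"

text \<open>
  The lamp sets \<open>F\<close> such that the origin is joined to \<open>(n, F)\<close> inside the block.
\<close>

definition front :: "nat \<Rightarrow> ((int \<times> int set) set \<Rightarrow> bool) \<Rightarrow> int set set" where
  "front n \<omega> = {F. (int n, F) \<in> cluster (induced_subgraph LG (block n)) \<omega> origin}"

text \<open>
  The cluster of the origin contains a vertex of height at least \<open>m\<close>.
\<close>

definition reaches :: "nat \<Rightarrow> ((int \<times> int set) set \<Rightarrow> bool) \<Rightarrow> bool" where
  "reaches m \<omega> \<longleftrightarrow> (\<exists>u\<in>cluster LG \<omega> origin. int m \<le> fst u)"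

lemma finite_block: "finite (block n)"
  by (simp add: block_def)

lemma block_subset_verts: "block n \<subseteq> verts LG"
  by (auto simp: block_def verts_LG intro: finite_subset[of _ "{0..int n}"])

lemma origin_in_block: "origin \<in> block n"
  by (simp add: origin_def block_def)

lemma verts_block: "verts (induced_subgraph LG (block n)) = block n"
  using block_subset_verts by (auto simp: induced_subgraph_def)

lemma front_subset: "front n \<omega> \<subseteq> Pow {0..int n}"
  using cluster_subset_verts[of "induced_subgraph LG (block n)" \<omega> origin]
  unfolding verts_block by (auto simp: front_def block_def)

lemma front_in_cluster: "F \<in> front n \<omega> \<Longrightarrow> (int n, F) \<in> cluster LG \<omega> origin"
  using cluster_mono[of "induced_subgraph LG (block n)" LG \<omega> \<omega> origin]
  by (auto simp: front_def induced_subgraph_def)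

text \<open>
  The only way out of the block is to step up from its top level.
\<close>

lemma edge_leaving_block:
  assumes "{x, y} \<in> edges LG" "x \<in> block n" "y \<notin> block n"
  obtains F where "x = (int n, F)" "y = (int n + 1, F)"
  using assms(1)
proof (cases rule: edges_LG_cases)
  case (1 j F)
  then have "x = (j, F) \<and> y = (j + 1, F) \<or> x = (j + 1, F) \<and> y = (j, F)"
    by (auto simp: up_edge_def doubleton_eq_iff)
  then show thesis using assms 1 by (intro that[of F]) (auto simp: block_def verts_LG)
next
  case (2 j F)
  then have "x = (j, F) \<and> y = (j, sym_diff F {j}) \<or> x = (j, sym_diff F {j}) \<and> y = (j, F)"
    by (auto simp: flip_edge_def doubleton_eq_iff)
  then have "x \<in> block n \<longleftrightarrow> y \<in> block n" using 2 by (auto simp: block_def verts_LG)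
  with assms show thesis by blast
qed

lemma exit_block:
  assumes "u \<in> cluster LG \<omega> origin" "u \<notin> block n"
  shows "\<exists>F\<in>front n \<omega>. \<omega> (up_edge (int n) F)"
proof -
  obtain x y where x: "x \<in> cluster (induced_subgraph LG (block n)) \<omega> origin"
    and y: "y \<notin> block n" "{x, y} \<in> edges LG" "\<omega> {x, y}"
    using cluster_exit[OF origin_in_block origin_in edges_LG_subset assms] by blast
  have "x \<in> block n" using x cluster_subset_verts[of "induced_subgraph LG (block n)" \<omega> origin]
    unfolding verts_block by blast
  from edge_leaving_block[OF y(2) this y(1)] obtain F where "x = (int n, F)" "y = (int n + 1, F)" .
  then show ?thesis using x y by (auto simp: front_def up_edge_def)
qed

lemma up_from_front:
  assumes "F \<in> front n \<omega>" "\<omega> (up_edge (int n) F)"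
  shows "(int n + 1, F) \<in> cluster LG \<omega> origin"
proof (rule cluster_step)
  have "(int n, F) \<in> block n" using front_subset assms(1) by (auto simp: block_def)
  then have V: "(int n, F) \<in> verts LG" using block_subset_verts by blast
  show "(int n, F) \<in> cluster LG \<omega> origin" by (rule front_in_cluster[OF assms(1)])
  show "{(int n, F), (int n + 1, F)} \<in> edges LG"
    using up_edge_in[OF V] by (simp add: up_edge_def)
  show "\<omega> {(int n, F), (int n + 1, F)}" using assms(2) by (simp add: up_edge_def)
  show "(int n + 1, F) \<in> verts LG" using V by (simp add: verts_LG)
qed

lemma reaches_SucD: "reaches (Suc n) \<omega> \<Longrightarrow> \<exists>F\<in>front n \<omega>. \<omega> (up_edge (int n) F)"
  by (auto simp: reaches_def block_def intro!: exit_block)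

lemma reaches_0: "reaches 0 \<omega>"
  unfolding reaches_def by (rule bexI[OF _ cluster_refl[OF origin_in]]) (simp add: origin_def)

lemma reaches_antimono: "reaches n \<omega> \<Longrightarrow> m \<le> n \<Longrightarrow> reaches m \<omega>"
  by (force simp: reaches_def)

lemma reaches_iff_front: "reaches n \<omega> \<longleftrightarrow> front n \<omega> \<noteq> {}"
proof
  assume r: "reaches n \<omega>"
  show "front n \<omega> \<noteq> {}"
  proof (cases n)
    case 0
    have "origin \<in> cluster (induced_subgraph LG (block 0)) \<omega> origin"
      by (intro cluster_refl) (simp only: verts_block origin_in_block)
    then show ?thesis using 0 by (auto simp: front_def origin_def)
  next
    case (Suc m)
    with r obtain F where F: "F \<in> front m \<omega>" "\<omega> (up_edge (int m) F)"
      using reaches_SucD by blast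
    have FS: "F \<subseteq> {0..int m}" using F(1) front_subset by blast
    have "(int m + 1, F) \<in> cluster (induced_subgraph LG (block n)) \<omega> origin"
    proof (rule cluster_step)
      have "block m \<subseteq> block n" using Suc by (auto simp: block_def)
      then show "(int m, F) \<in> cluster (induced_subgraph LG (block n)) \<omega> origin"
        using F(1) cluster_mono[of "induced_subgraph LG (block m)" "induced_subgraph LG (block n)" \<omega> \<omega> origin]
        by (auto simp: front_def induced_subgraph_def)
      have "(int m, F) \<in> block m" using FS by (simp add: block_def)
      then have "up_edge (int m) F \<in> edges LG" using block_subset_verts up_edge_in by blast
      moreover have "up_edge (int m) F \<subseteq> block n" using FS Suc by (auto simp: up_edge_def block_def)
      ultimately show "{(int m, F), (int m + 1, F)} \<in> edges (induced_subgraph LG (block n))"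
        by (simp add: induced_subgraph_def up_edge_def)
      show "\<omega> {(int m, F), (int m + 1, F)}" using F(2) by (simp add: up_edge_def)
      show "(int m + 1, F) \<in> verts (induced_subgraph LG (block n))"
        unfolding verts_block using FS Suc by (auto simp: block_def)
    qed
    then show ?thesis using Suc by (auto simp: front_def add.commute)
  qed
next
  assume "front n \<omega> \<noteq> {}"
  then obtain F where "F \<in> front n \<omega>" by blast
  from front_in_cluster[OF this] show "reaches n \<omega>" by (force simp: reaches_def)
qed

lemma infinite_cluster_origin_iff: "infinite (cluster LG \<omega> origin) \<longleftrightarrow> (\<forall>m. reaches m \<omega>)"
proof
  assume inf: "infinite (cluster LG \<omega> origin)"
  show "\<forall>m. reaches m \<omega>"
  proof
    fix m
    have "\<not> cluster LG \<omega> origin \<subseteq> block m" using inf finite_block finite_subset by blast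
    then obtain F where "F \<in> front m \<omega>" using exit_block by blast
    then show "reaches m \<omega>" using reaches_iff_front by blast
  qed
next
  assume r: "\<forall>m. reaches m \<omega>"
  show "infinite (cluster LG \<omega> origin)"
  proof
    assume "finite (cluster LG \<omega> origin)"
    then have "bdd_above (fst ` cluster LG \<omega> origin)" by simp
    then obtain B where B: "fst u \<le> B" if "u \<in> cluster LG \<omega> origin" for u
      by (auto simp: bdd_above_def)
    have "reaches (nat (B + 1)) \<omega>" using r by blast
    then obtain u where "u \<in> cluster LG \<omega> origin" "int (nat (B + 1)) \<le> fst u"
      by (auto simp: reaches_def)
    with B[of u] show False by linarith
  qed
qed

section \<open>Copies of the graph inside itself\<close>

text \<open>
  The embedding of the half-lamplighter graph onto its part above height \<open>n\<close> in which the lamps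
  \<open>0, ..., n\<close> are frozen in the state \<open>F \<subseteq> {0..n}\<close>; \<open>copy n F \<omega>\<close> is the configuration
  seen in that part, transported back to the whole graph.
\<close>

definition into_copy :: "nat \<Rightarrow> int set \<Rightarrow> int \<times> int set \<Rightarrow> int \<times> int set" where
  "into_copy n F = (\<lambda>(j, C). (int n + 1 + j, F \<union> (\<lambda>k. int n + 1 + k) ` C))"

definition copy :: "nat \<Rightarrow> int set \<Rightarrow> ((int \<times> int set) set \<Rightarrow> bool) \<Rightarrow> (int \<times> int set) set \<Rightarrow> bool" where
  "copy n F \<omega> = (\<lambda>e\<in>edges LG. \<omega> (into_copy n F ` e))"

lemma into_copy_verts: "F \<subseteq> {0..int n} \<Longrightarrow> into_copy n F ` verts LG \<subseteq> verts LG"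
  by (force simp: into_copy_def verts_LG intro: finite_subset[of F "{0..int n}"])

lemma into_copy_lamps:
  assumes "F \<subseteq> {0..int n}" "v \<in> verts LG"
  shows "snd (into_copy n F v) \<inter> {0..int n} = F"
    and "(\<lambda>k. k - int n - 1) ` (snd (into_copy n F v) - {0..int n}) = snd v"
proof -
  obtain j C where v: "v = (j, C)" by fastforce
  have C: "0 \<le> k" if "k \<in> C" for k using assms(2) that by (auto simp: v verts_LG)
  show "snd (into_copy n F v) \<inter> {0..int n} = F"
    using assms(1) by (auto simp: v into_copy_def dest: C)
  have "snd (into_copy n F v) - {0..int n} = (\<lambda>k. int n + 1 + k) ` snd v"
    using assms(1) by (auto simp: v into_copy_def dest: C)
  then show "(\<lambda>k. k - int n - 1) ` (snd (into_copy n F v) - {0..int n}) = snd v"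
    by (simp add: image_image)
qed

lemma inj_on_into_copy: "F \<subseteq> {0..int n} \<Longrightarrow> inj_on (into_copy n F) (verts LG)"
proof (rule inj_onI)
  fix u v assume F: "F \<subseteq> {0..int n}" and uv: "u \<in> verts LG" "v \<in> verts LG" and eq: "into_copy n F u = into_copy n F v"
  have "snd u = snd v"
    using into_copy_lamps(2)[OF F uv(1)] into_copy_lamps(2)[OF F uv(2)] eq by simp
  moreover have "fst u = fst v" using eq by (auto simp: into_copy_def split: prod.splits)
  ultimately show "u = v" by (simp add: prod_eq_iff)
qed

lemma into_copy_edges:
  assumes F: "F \<subseteq> {0..int n}" and e: "e \<in> edges LG"
  shows "into_copy n F ` e \<in> edges LG"
  using e
proof (cases rule: edges_LG_cases)
  case (1 j C)
  then have "into_copy n F (j, C) \<in> verts LG" using into_copy_verts[OF F] by blast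
  then have "up_edge (int n + 1 + j) (F \<union> (\<lambda>k. int n + 1 + k) ` C) \<in> edges LG"
    by (intro up_edge_in) (simp add: into_copy_def)
  also have "up_edge (int n + 1 + j) (F \<union> (\<lambda>k. int n + 1 + k) ` C) = into_copy n F ` e"
    by (simp add: 1 up_edge_def into_copy_def)
  finally show ?thesis .
next
  case (2 j C)
  then have "into_copy n F (j, C) \<in> verts LG" using into_copy_verts[OF F] by blast
  then have "flip_edge (int n + 1 + j) (F \<union> (\<lambda>k. int n + 1 + k) ` C) \<in> edges LG"
    by (intro flip_edge_in) (simp add: into_copy_def)
  also have "sym_diff (F \<union> (\<lambda>k. int n + 1 + k) ` C) {int n + 1 + j} =
      F \<union> (\<lambda>k. int n + 1 + k) ` sym_diff C {j}"
    using F 2 by (auto simp: verts_LG)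
  then have "flip_edge (int n + 1 + j) (F \<union> (\<lambda>k. int n + 1 + k) ` C) = into_copy n F ` e"
    by (simp add: 2 flip_edge_def into_copy_def)
  finally show ?thesis .
qed

lemma inj_on_into_copy_edges: "F \<subseteq> {0..int n} \<Longrightarrow> inj_on ((`) (into_copy n F)) (edges LG)"
  by (rule inj_on_subset[OF inj_on_image_Pow[OF inj_on_into_copy] edges_LG_subset])

lemma copy_cluster:
  assumes "F \<subseteq> {0..int n}" "v \<in> verts LG"
  shows "into_copy n F ` cluster LG (copy n F \<omega>) v \<subseteq> cluster LG \<omega> (into_copy n F v)"
  using cluster_map[OF into_copy_verts[OF assms(1)] into_copy_edges[OF assms(1)] edges_LG_subset assms(2)]
  by (auto simp: copy_def)

lemma copy_reaches:
  assumes F: "F \<in> front n \<omega>" and up: "\<omega> (up_edge (int n) F)" and r: "reaches m (copy n F \<omega>)"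
  shows "reaches (Suc n + m) \<omega>"
proof -
  have FS: "F \<subseteq> {0..int n}" using F front_subset by blast
  from r obtain u where u: "u \<in> cluster LG (copy n F \<omega>) origin" "int m \<le> fst u"
    by (auto simp: reaches_def)
  have "into_copy n F u \<in> cluster LG \<omega> (into_copy n F origin)"
    using copy_cluster[OF FS origin_in] u by blast
  moreover have "into_copy n F origin = (int n + 1, F)" by (simp add: into_copy_def origin_def)
  moreover note up_from_front[OF F up]
  ultimately have "into_copy n F u \<in> cluster LG \<omega> origin" using cluster_trans by metis
  moreover have "int (Suc n + m) \<le> fst (into_copy n F u)" using u(2) by (cases u) (simp add: into_copy_def)
  ultimately show ?thesis unfolding reaches_def by blast
qed

lemma copy_has_infinite_cluster:
  assumes F: "F \<subseteq> {0..int n}" and inf: "has_infinite_cluster LG (copy n F \<omega>)"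
  shows "has_infinite_cluster LG \<omega>"
proof -
  obtain v where v: "v \<in> verts LG" "infinite (cluster LG (copy n F \<omega>) v)"
    using inf by (auto simp: has_infinite_cluster_def)
  have "infinite (into_copy n F ` cluster LG (copy n F \<omega>) v)"
    using v(2) inj_on_subset[OF inj_on_into_copy[OF F] cluster_subset_verts] finite_imageD by blast
  then have "infinite (cluster LG \<omega> (into_copy n F v))"
    using copy_cluster[OF F v(1)] finite_subset by blast
  then show ?thesis
    using into_copy_verts[OF F] v(1) by (auto simp: has_infinite_cluster_def)
qed

text \<open>
  The edges of the copy together with the edge leading up to it from \<open>(n, F)\<close>. For different
  \<open>F\<close> these sets are disjoint, and they are disjoint from the edges of the block.
\<close>

definition stem_copy :: "nat \<Rightarrow> int set \<Rightarrow> (int \<times> int set) set set" where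
  "stem_copy n F = insert (up_edge (int n) F) ((`) (into_copy n F) ` edges LG)"

lemma edge_nonempty: "e \<in> edges LG \<Longrightarrow> e \<noteq> {}"
  by (erule edges_LG_cases) (auto simp: up_edge_def flip_edge_def)

lemma into_copy_edge_vertex:
  assumes "F \<subseteq> {0..int n}" "e \<in> edges LG"
  obtains v where "v \<in> into_copy n F ` e" "int n + 1 \<le> fst v"
proof -
  from edge_nonempty[OF assms(2)] obtain u where u: "u \<in> e" by blast
  then have "u \<in> verts LG" using assms(2) edges_LG_subset by blast
  then show thesis using u that[of "into_copy n F u"] by (auto simp: into_copy_def verts_LG)
qed

lemma stem_copy_lamps:
  assumes "F \<subseteq> {0..int n}" "e \<in> stem_copy n F" "v \<in> e"
  shows "snd v \<inter> {0..int n} = F"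
  using assms into_copy_lamps(1)[OF assms(1)] edges_LG_subset
  by (fastforce simp: stem_copy_def up_edge_def)

lemma stem_copy_vertex:
  assumes "F \<subseteq> {0..int n}" "e \<in> stem_copy n F"
  obtains v where "v \<in> e" "int n + 1 \<le> fst v"
proof (cases "e = up_edge (int n) F")
  case True
  then show thesis using that[of "(int n + 1, F)"] by (auto simp: up_edge_def)
next
  case False
  then obtain e' where "e' \<in> edges LG" "e = into_copy n F ` e'" using assms(2) by (auto simp: stem_copy_def)
  then show thesis using into_copy_edge_vertex[OF assms(1)] that by blast
qed

lemma stem_copy_subset:
  assumes "F \<subseteq> {0..int n}" shows "stem_copy n F \<subseteq> edges LG"
proof -
  have "(int n, F) \<in> verts LG" using assms block_subset_verts[of n] by (auto simp: block_def)
  then show ?thesis using into_copy_edges[OF assms] by (auto simp: stem_copy_def intro: up_edge_in)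
qed

lemma disjoint_stem_copies: "disjoint_family_on (stem_copy n) (Pow {0..int n})"
proof (unfold disjoint_family_on_def, intro ballI impI)
  fix F F' assume F: "F \<in> Pow {0..int n}" "F' \<in> Pow {0..int n}" "F \<noteq> F'"
  {
    fix e assume e: "e \<in> stem_copy n F" "e \<in> stem_copy n F'"
    obtain v where "v \<in> e" using stem_copy_vertex[of F n e] F(1) e(1) by blast
    then have False using stem_copy_lamps[of F n e v] stem_copy_lamps[of F' n e v] e F by auto
  }
  then show "stem_copy n F \<inter> stem_copy n F' = {}" by blast
qed

lemma block_edges_stem_copy:
  assumes "F \<subseteq> {0..int n}"
  shows "edges (induced_subgraph LG (block n)) \<inter> stem_copy n F = {}"
proof -
  {
    fix e assume e: "e \<in> stem_copy n F" "e \<subseteq> block n"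
    obtain v where "v \<in> e" "int n + 1 \<le> fst v" using stem_copy_vertex[OF assms e(1)] by blast
    then have False using e(2) by (auto simp: block_def)
  }
  then show ?thesis by (auto simp: induced_subgraph_def)
qed

lemma up_edge_not_in_copy:
  assumes "F \<subseteq> {0..int n}"
  shows "up_edge (int n) F \<notin> (`) (into_copy n F) ` edges LG"
proof
  assume "up_edge (int n) F \<in> (`) (into_copy n F) ` edges LG"
  then obtain e where e: "e \<in> edges LG" "up_edge (int n) F = into_copy n F ` e" by blast
  have "(int n, F) \<in> into_copy n F ` e" unfolding e(2)[symmetric] by (simp add: up_edge_def)
  then obtain v where "v \<in> e" "(int n, F) = into_copy n F v" by blast
  moreover from this(1) have "v \<in> verts LG" using e(1) edges_LG_subset by blast
  then have "0 \<le> fst v" by (auto simp: verts_LG)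
  ultimately show False by (cases v) (simp add: into_copy_def)
qed

section \<open>Measurability and locality of the front\<close>

lemma depends_on_front: "depends_on (front n) (edges (induced_subgraph LG (block n)))"
  unfolding front_def[abs_def] by (rule depends_on_comp[OF depends_on_cluster])

lemma depends_on_copy: "depends_on (copy n F) ((`) (into_copy n F) ` edges LG)"
  by (rule depends_onI) (auto simp: copy_def restrict_def)

lemma block_edges_subset: "edges (induced_subgraph LG (block n)) \<subseteq> edges LG"
  by (auto simp: induced_subgraph_def)

lemma finite_block_edges: "finite (edges (induced_subgraph LG (block n)))"
  by (rule finite_subset[of _ "Pow (block n)"]) (auto simp: induced_subgraph_def finite_block)

lemma pred_front: "Measurable.pred (percolation LG p) (\<lambda>\<omega>. front n \<omega> = S)"
proof (cases "S \<subseteq> Pow {0..int n}")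
  case True
  have eq: "front n \<omega> = S \<longleftrightarrow>
      (\<forall>F\<in>Pow {0..int n}. (int n, F) \<in> cluster (induced_subgraph LG (block n)) \<omega> origin \<longleftrightarrow> F \<in> S)" for \<omega>
  proof -
    have "front n \<omega> = S \<longleftrightarrow> (\<forall>F\<in>Pow {0..int n}. F \<in> front n \<omega> \<longleftrightarrow> F \<in> S)"
      using True front_subset[of n \<omega>] by blast
    then show ?thesis by (simp add: front_def)
  qed
  have "Measurable.pred (percolation LG p)
      (\<lambda>\<omega>. (int n, F) \<in> cluster (induced_subgraph LG (block n)) \<omega> origin)" for F
  proof (rule pred_cluster)
    show "countable (verts (induced_subgraph LG (block n)))"
      unfolding verts_block by (rule countable_finite[OF finite_block])
    show "edges (induced_subgraph LG (block n)) \<subseteq> Pow (verts (induced_subgraph LG (block n)))"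
      unfolding verts_block by (auto simp: induced_subgraph_def)
  qed (rule block_edges_subset)
  then show ?thesis
    unfolding eq by (intro pred_intros_finite(3) pred_intros_logic(6)) auto
next
  case False
  then have "front n \<omega> \<noteq> S" for \<omega> using front_subset by blast
  then show ?thesis by simp
qed

lemma pred_reaches: "Measurable.pred (percolation LG p) (reaches m)"
proof -
  have "reaches m = (\<lambda>\<omega>. \<exists>u\<in>verts LG. u \<in> cluster LG \<omega> origin \<and> int m \<le> fst u)"
    unfolding reaches_def[abs_def] using cluster_subset_verts[of LG _ origin] by (intro ext) blast
  then show ?thesis
    by (simp only:) (intro pred_countable_Bex countable_verts_LG pred_intros_conj2' pred_cluster
        edges_LG_subset order_refl)
qed

lemma copy_percolation:
  assumes F: "F \<subseteq> {0..int n}" and P: "Measurable.pred (percolation LG p) P"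
  shows "Measurable.pred (percolation LG p) (\<lambda>\<omega>. P (copy n F \<omega>))"
    and "perc_prob LG p (\<lambda>\<omega>. P (copy n F \<omega>)) = perc_prob LG p P"
  unfolding copy_def
  using perc_prob_reindex[OF inj_on_into_copy_edges[OF F] _ P, of LG] into_copy_edges[OF F] by auto

section \<open>One generation of exploration\<close>

abbreviation fronts :: "nat \<Rightarrow> int set set set" where "fronts n \<equiv> Pow (Pow {0..int n})"

text \<open>
  The distribution of the front, the expected size of the front, and the probability of reaching
  height \<open>m\<close>.
\<close>

definition front_prob :: "real \<Rightarrow> nat \<Rightarrow> int set set \<Rightarrow> real" where
  "front_prob p n S = perc_prob LG p (\<lambda>\<omega>. front n \<omega> = S)"

definition mean_front :: "real \<Rightarrow> nat \<Rightarrow> real" where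
  "mean_front p n = (\<Sum>S\<in>fronts n. front_prob p n S * card S)"

definition reach_prob :: "real \<Rightarrow> nat \<Rightarrow> real" where
  "reach_prob p m = perc_prob LG p (reaches m)"

lemma front_prob_nonneg: "0 \<le> front_prob p n S"
  by (simp add: front_prob_def)

lemma front_partition:
  assumes Q: "Measurable.pred (percolation LG p) Q"
  shows "perc_prob LG p Q = (\<Sum>S\<in>fronts n. perc_prob LG p (\<lambda>\<omega>. front n \<omega> = S \<and> Q \<omega>))"
proof -
  let ?M = "percolation LG p"
  interpret M: prob_space ?M by (rule prob_space_percolation)
  have "{\<omega> \<in> space ?M. Q \<omega>} = (\<Union>S\<in>fronts n. {\<omega> \<in> space ?M. front n \<omega> = S \<and> Q \<omega>})"
    using front_subset by auto
  moreover have "M.prob (\<Union>S\<in>fronts n. {\<omega> \<in> space ?M. front n \<omega> = S \<and> Q \<omega>}) =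
      (\<Sum>S\<in>fronts n. perc_prob LG p (\<lambda>\<omega>. front n \<omega> = S \<and> Q \<omega>))"
  proof (rule M.finite_measure_finite_Union)
    show "(\<lambda>S. {\<omega> \<in> space ?M. front n \<omega> = S \<and> Q \<omega>}) ` fronts n \<subseteq> M.events"
      using pred_intros_logic(3)[OF pred_front Q] by (auto simp: pred_def)
  qed (auto simp: disjoint_family_on_def)
  ultimately show ?thesis by simp
qed

lemma sum_front_prob: "(\<Sum>S\<in>fronts n. front_prob p n S) = 1"
proof -
  interpret M: prob_space "percolation LG p" by (rule prob_space_percolation)
  have "(\<Sum>S\<in>fronts n. front_prob p n S) = perc_prob LG p (\<lambda>_. True)"
    unfolding front_prob_def by (subst front_partition[where n=n]) auto
  then show ?thesis using M.prob_space by simp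
qed

lemma perc_prob_not:
  assumes "Measurable.pred (percolation H p) P"
  shows "perc_prob H p (\<lambda>\<omega>. \<not> P \<omega>) = 1 - perc_prob H p P"
proof -
  interpret M: prob_space "percolation H p" by (rule prob_space_percolation)
  show ?thesis by (rule M.prob_neg) (use assms in \<open>simp add: pred_def\<close>)
qed

lemma front_prob_empty: "front_prob p n {} = 1 - reach_prob p n"
  unfolding front_prob_def reach_prob_def perc_prob_not[OF pred_reaches, symmetric]
  by (simp add: reaches_iff_front)

lemma front_indep:
  assumes S: "S \<in> fronts n"
    and P: "\<And>F. F \<in> S \<Longrightarrow> Measurable.pred (percolation LG p) (P F)"
    and dep: "\<And>F. F \<in> S \<Longrightarrow> depends_on (P F) (stem_copy n F)"
    and r: "\<And>F. F \<in> S \<Longrightarrow> perc_prob LG p (P F) = r"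
  shows "perc_prob LG p (\<lambda>\<omega>. front n \<omega> = S \<and> (\<forall>F\<in>S. P F \<omega>)) = front_prob p n S * r ^ card S"
proof -
  have FS: "F \<subseteq> {0..int n}" if "F \<in> S" for F using S that by blast
  have "perc_prob LG p (\<lambda>\<omega>. front n \<omega> = S \<and> (\<forall>F\<in>S. P F \<omega>)) =
      perc_prob LG p (\<lambda>\<omega>. front n \<omega> = S) * (\<Prod>F\<in>S. perc_prob LG p (P F))"
  proof (rule perc_prob_indep_insert[where K="stem_copy n"])
    show "finite S" using S finite_subset by auto
    show "disjoint_family_on (stem_copy n) S"
      using disjoint_family_on_mono[OF _ disjoint_stem_copies[of n], of S] S by blast
    show "depends_on (\<lambda>\<omega>. front n \<omega> = S) (edges (induced_subgraph LG (block n)))"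
      by (rule depends_on_comp[OF depends_on_front])
    show "stem_copy n F \<subseteq> edges LG" "edges (induced_subgraph LG (block n)) \<inter> stem_copy n F = {}"
      if "F \<in> S" for F
      by (rule stem_copy_subset[OF FS[OF that]] block_edges_stem_copy[OF FS[OF that]])+
  qed (fact edges_LG_nonempty block_edges_subset pred_front P dep)+
  then show ?thesis by (simp add: r front_prob_def)
qed

lemma up_edge_in_LG: "F \<subseteq> {0..int n} \<Longrightarrow> up_edge (int n) F \<in> edges LG"
  using stem_copy_subset[of F n] by (auto simp: stem_copy_def)

text \<open>
  Each point of the front at height \<open>n\<close> independently starts a new copy with probability \<open>p\<close>,
  which then reaches relative height \<open>m\<close> with probability \<open>reach_prob p m\<close>. So the
  probabilities of failure satisfy the recursion of a Galton--Watson process, as an inequality.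
\<close>

lemma branching_bound:
  assumes p: "0 \<le> p" "p \<le> 1"
  shows "1 - reach_prob p (Suc n + m) \<le>
    (\<Sum>S\<in>fronts n. front_prob p n S * (1 - p * reach_prob p m) ^ card S)"
proof -
  interpret M: prob_space "percolation LG p" by (rule prob_space_percolation)
  define Q where "Q F \<omega> \<longleftrightarrow> \<omega> (up_edge (int n) F) \<and> reaches m (copy n F \<omega>)"
    for F and \<omega> :: "(int \<times> int set) set \<Rightarrow> bool"
  have pr: "Measurable.pred (percolation LG p) (Q F)" if "F \<subseteq> {0..int n}" for F
    unfolding Q_def[abs_def]
    using that by (intro pred_intros_logic(3) copy_percolation(1) pred_reaches pred_edge_open up_edge_in_LG)
  have dep: "depends_on (Q F) (stem_copy n F)" for F
  proof (rule depends_onI)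
    fix \<omega> \<omega>' :: "(int \<times> int set) set \<Rightarrow> bool"
    assume *: "\<And>e. e \<in> stem_copy n F \<Longrightarrow> \<omega> e = \<omega>' e"
    then have "copy n F \<omega> = copy n F \<omega>'"
      by (intro depends_onD[OF depends_on_copy]) (auto simp: stem_copy_def)
    then show "Q F \<omega> = Q F \<omega>'" using * by (simp add: Q_def stem_copy_def)
  qed
  have prob: "perc_prob LG p (Q F) = p * reach_prob p m" if F: "F \<subseteq> {0..int n}" for F
  proof -
    have "perc_prob LG p (Q F) =
        perc_prob LG p (\<lambda>\<omega>. \<omega> (up_edge (int n) F)) * perc_prob LG p (\<lambda>\<omega>. reaches m (copy n F \<omega>))"
      unfolding Q_def[abs_def]
    proof (rule perc_prob_indep2[where J="{up_edge (int n) F}" and K="(`) (into_copy n F) ` edges LG"])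
      show "depends_on (\<lambda>\<omega>. reaches m (copy n F \<omega>)) ((`) (into_copy n F) ` edges LG)"
        by (rule depends_on_comp[OF depends_on_copy])
      show "depends_on (\<lambda>\<omega>. \<omega> (up_edge (int n) F)) {up_edge (int n) F}"
        by (simp add: depends_on_def)
    qed (use F in \<open>auto intro: edges_LG_nonempty up_edge_in_LG into_copy_edges pred_edge_open
        copy_percolation(1) pred_reaches simp: up_edge_not_in_copy\<close>)
    then show ?thesis
      using F p by (simp add: perc_prob_edge_open up_edge_in_LG copy_percolation(2) pred_reaches reach_prob_def)
  qed
  have "1 - reach_prob p (Suc n + m) = perc_prob LG p (\<lambda>\<omega>. \<not> reaches (Suc n + m) \<omega>)"
    unfolding reach_prob_def by (rule perc_prob_not[OF pred_reaches, symmetric])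
  also have "\<dots> = (\<Sum>S\<in>fronts n. perc_prob LG p (\<lambda>\<omega>. front n \<omega> = S \<and> \<not> reaches (Suc n + m) \<omega>))"
    by (rule front_partition) (intro pred_intros_logic(2) pred_reaches)
  also have "\<dots> \<le> (\<Sum>S\<in>fronts n. perc_prob LG p (\<lambda>\<omega>. front n \<omega> = S \<and> (\<forall>F\<in>S. \<not> Q F \<omega>)))"
  proof (rule sum_mono)
    fix S assume S: "S \<in> fronts n"
    have "Measurable.pred (percolation LG p) (\<lambda>\<omega>. front n \<omega> = S \<and> (\<forall>F\<in>S. \<not> Q F \<omega>))"
      using S by (intro pred_intros_logic(3) pred_front pred_intros_finite(3) pred_intros_logic(2) pr)
        (auto intro: finite_subset)
    then show "perc_prob LG p (\<lambda>\<omega>. front n \<omega> = S \<and> \<not> reaches (Suc n + m) \<omega>) \<le>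
        perc_prob LG p (\<lambda>\<omega>. front n \<omega> = S \<and> (\<forall>F\<in>S. \<not> Q F \<omega>))"
      using copy_reaches by (intro M.finite_measure_mono) (auto simp: pred_def Q_def)
  qed
  also have "\<dots> = (\<Sum>S\<in>fronts n. front_prob p n S * (1 - p * reach_prob p m) ^ card S)"
  proof (intro sum.cong refl front_indep)
    fix S F assume "S \<in> fronts n" "F \<in> S"
    then have F: "F \<subseteq> {0..int n}" by blast
    show "Measurable.pred (percolation LG p) (\<lambda>\<omega>. \<not> Q F \<omega>)"
      using pr[OF F] by (rule pred_intros_logic(2))
    show "depends_on (\<lambda>\<omega>. \<not> Q F \<omega>) (stem_copy n F)" by (rule depends_on_comp[OF dep])
    show "perc_prob LG p (\<lambda>\<omega>. \<not> Q F \<omega>) = 1 - p * reach_prob p m"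
      using perc_prob_not[OF pr[OF F]] prob[OF F] by simp
  qed auto
  finally show ?thesis .
qed

text \<open>
  Conversely, if all edges leading up from the front are closed, then the cluster of the origin
  stops at height \<open>n\<close>.
\<close>

lemma dying_bound:
  assumes p: "0 \<le> p" "p \<le> 1"
  shows "(\<Sum>S\<in>fronts n. front_prob p n S * (1 - p) ^ card S) \<le> 1 - reach_prob p (Suc n)"
proof -
  interpret M: prob_space "percolation LG p" by (rule prob_space_percolation)
  have "(\<Sum>S\<in>fronts n. front_prob p n S * (1 - p) ^ card S) =
      (\<Sum>S\<in>fronts n. perc_prob LG p (\<lambda>\<omega>. front n \<omega> = S \<and> (\<forall>F\<in>S. \<not> \<omega> (up_edge (int n) F))))"
  proof (intro sum.cong refl front_indep[symmetric])
    fix S F assume "S \<in> fronts n" "F \<in> S"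
    then have F: "up_edge (int n) F \<in> edges LG" by (intro up_edge_in_LG) blast
    show "Measurable.pred (percolation LG p) (\<lambda>\<omega>. \<not> \<omega> (up_edge (int n) F))"
      using pred_edge_open[OF F] by (rule pred_intros_logic(2))
    show "depends_on (\<lambda>\<omega>. \<not> \<omega> (up_edge (int n) F)) (stem_copy n F)"
      by (auto simp: depends_on_def stem_copy_def)
    show "perc_prob LG p (\<lambda>\<omega>. \<not> \<omega> (up_edge (int n) F)) = 1 - p"
      using perc_prob_not[OF pred_edge_open[OF F]] perc_prob_edge_open[OF F p] by simp
  qed auto
  also have "\<dots> \<le> (\<Sum>S\<in>fronts n. perc_prob LG p (\<lambda>\<omega>. front n \<omega> = S \<and> \<not> reaches (Suc n) \<omega>))"
  proof (rule sum_mono)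
    fix S
    have "Measurable.pred (percolation LG p) (\<lambda>\<omega>. front n \<omega> = S \<and> \<not> reaches (Suc n) \<omega>)"
      by (intro pred_intros_logic(3) pred_front pred_intros_logic(2) pred_reaches)
    then show "perc_prob LG p (\<lambda>\<omega>. front n \<omega> = S \<and> (\<forall>F\<in>S. \<not> \<omega> (up_edge (int n) F))) \<le>
        perc_prob LG p (\<lambda>\<omega>. front n \<omega> = S \<and> \<not> reaches (Suc n) \<omega>)"
      by (intro M.finite_measure_mono) (auto simp: pred_def dest: reaches_SucD)
  qed
  also have "\<dots> = perc_prob LG p (\<lambda>\<omega>. \<not> reaches (Suc n) \<omega>)"
    by (rule front_partition[symmetric]) (intro pred_intros_logic(2) pred_reaches)
  also have "\<dots> = 1 - reach_prob p (Suc n)"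
    unfolding reach_prob_def by (rule perc_prob_not[OF pred_reaches])
  finally show ?thesis .
qed

lemma reach_prob_bounds: "0 \<le> reach_prob p m" "reach_prob p m \<le> 1"
proof -
  interpret M: prob_space "percolation LG p" by (rule prob_space_percolation)
  show "0 \<le> reach_prob p m" "reach_prob p m \<le> 1" by (simp_all add: reach_prob_def)
qed

lemma reach_prob_antimono: "m \<le> n \<Longrightarrow> reach_prob p n \<le> reach_prob p m"
proof -
  interpret M: prob_space "percolation LG p" by (rule prob_space_percolation)
  assume "m \<le> n"
  then show ?thesis
    unfolding reach_prob_def using pred_reaches[of m p]
    by (intro M.finite_measure_mono) (auto simp: pred_def dest: reaches_antimono)
qed

lemma reach_prob_0: "reach_prob p 0 = 1"
proof -
  interpret M: prob_space "percolation LG p" by (rule prob_space_percolation)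
  show ?thesis using M.prob_space by (simp add: reach_prob_def reaches_0)
qed

section \<open>Percolation forces a large mean front\<close>

lemma mean_front_0_at_1: "mean_front 1 0 \<ge> 2"
proof -
  interpret M: prob_space "percolation LG 1" by (rule prob_space_percolation)
  have V: "(0, {}) \<in> verts LG" using origin_in by (simp add: origin_def)
  have flip: "front 0 \<omega> = {{}, {0}}" if \<omega>: "\<omega> (flip_edge 0 {})" for \<omega>
  proof -
    have o: "origin \<in> cluster (induced_subgraph LG (block 0)) \<omega> origin"
      by (intro cluster_refl) (simp only: verts_block origin_in_block)
    have "(0, {0}) \<in> cluster (induced_subgraph LG (block 0)) \<omega> origin"
    proof (rule cluster_step[OF o])
      show "{origin, (0, {0})} \<in> edges (induced_subgraph LG (block 0))"
        using flip_edge_in[OF V] by (simp add: induced_subgraph_def flip_edge_def origin_def block_def)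
      show "\<omega> {origin, (0, {0})}" using \<omega> by (simp add: flip_edge_def origin_def)
      show "(0, {0}) \<in> verts (induced_subgraph LG (block 0))"
        unfolding verts_block by (simp add: block_def)
    qed
    then have "{{}, {0}} \<subseteq> front 0 \<omega>" using o by (simp add: front_def origin_def)
    moreover have "front 0 \<omega> \<subseteq> {{}, {0}}" using front_subset[of 0 \<omega>] by auto
    ultimately show ?thesis by blast
  qed
  have "1 = perc_prob LG 1 (\<lambda>\<omega>. \<omega> (flip_edge 0 {}))"
    using perc_prob_edge_open[OF flip_edge_in[OF V], of 1] by simp
  also have "\<dots> \<le> front_prob 1 0 {{}, {0}}"
    unfolding front_prob_def using pred_front[of 0 "{{}, {0}}" 1]
    by (intro M.finite_measure_mono) (auto simp: pred_def flip)
  finally have "2 \<le> front_prob 1 0 {{}, {0}} * card {{}, {0 :: int}}" by simp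
  also have "\<dots> \<le> mean_front 1 0"
    unfolding mean_front_def by (rule member_le_sum) (auto simp: front_prob_nonneg)
  finally show ?thesis .
qed

text \<open>
  If all mean fronts were at most \<open>1 / p\<close>, then by Markov's inequality the front would, with
  probability bounded below, be nonempty of size at most a constant \<open>M\<close>, and then all edges
  above it are closed with probability at least \<open>(1 - p) ^ M\<close>. So each step would cost a fixed
  amount of \<open>reach_prob\<close>. This needs \<open>p < 1\<close>; at \<open>p = 1\<close> the front at height \<open>0\<close> has
  two elements.
\<close>

lemma large_front:
  assumes p: "0 < p" "p \<le> 1" and \<theta>: "0 < \<theta>" "\<And>m. \<theta> \<le> reach_prob p m"
  shows "\<exists>n. 1 < p * mean_front p n"
proof (cases "p = 1")
  case True
  then show ?thesis using mean_front_0_at_1 by (intro exI[of _ 0]) simp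
next
  case False
  with p have p1: "p < 1" by simp
  show ?thesis
  proof (rule ccontr)
    assume "\<not> ?thesis"
    then have mean: "p * mean_front p n \<le> 1" for n by (simp add: not_less)
    \<comment> \<open>by Markov, a front is larger than this \<open>M\<close> with probability at most \<open>\<theta> / 2\<close>\<close>
    obtain M :: nat where M: "2 / (p * \<theta>) < M" using reals_Archimedean2 by blast
    have p\<theta>: "0 < p * \<theta>" using p \<theta> by simp
    then have "0 < 2 / (p * \<theta>)" by simp
    from this p\<theta> have pM: "0 < p * \<theta>" "0 < real M" using M by linarith+
    define d where "d = (1 - p) ^ M"
    have d: "0 < d" "d \<le> 1" using p p1 by (auto simp: d_def power_le_one)
    have step: "reach_prob p (Suc n) \<le> reach_prob p n - d * \<theta> / 2" for n
    proof -
      \<comment> \<open>Markov's inequality in pointwise form; it is averaged over the law of the front below\<close>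
      have pt: "(1 - d) * of_bool (S = {}) + d * (1 - card S / M) \<le> (1 - p) ^ card S" for S :: "int set set"
      proof (cases "card S \<le> M")
        case True
        have 1: "d \<le> (1 - p) ^ card S"
          unfolding d_def using True p p1 by (intro power_decreasing) auto
        have 2: "d * (1 - card S / M) \<le> d * 1" using d by (intro mult_left_mono) auto
        show ?thesis
        proof (cases "S = {}")
          case False
          then show ?thesis using 1 2 by simp
        qed simp
      next
        case False
        then have "S \<noteq> {}" "1 - card S / M \<le> 0" using pM by (auto simp: field_simps)
        then have "(1 - d) * of_bool (S = {}) + d * (1 - card S / M) \<le> 0"
          using d by (simp add: mult_nonneg_nonpos)
        also have "0 \<le> (1 - p) ^ card S" using p1 by simp
        finally show ?thesis .
      qed
      have "(\<Sum>S\<in>fronts n. front_prob p n S * ((1 - d) * of_bool (S = {}) + d * (1 - card S / M))) =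
          (1 - d) * (\<Sum>S\<in>fronts n. front_prob p n S * of_bool (S = {})) +
          d * ((\<Sum>S\<in>fronts n. front_prob p n S) - (\<Sum>S\<in>fronts n. front_prob p n S * card S) / M)"
      proof -
        have "front_prob p n S * ((1 - d) * of_bool (S = {}) + d * (1 - card S / M)) =
            (1 - d) * (front_prob p n S * of_bool (S = {})) +
            d * (front_prob p n S - front_prob p n S * card S / M)" for S
          by (simp add: algebra_simps)
        then show ?thesis
          by (simp only: sum.distrib sum_subtractf sum_distrib_left[symmetric] sum_divide_distrib[symmetric])
      qed
      also have "(\<Sum>S\<in>fronts n. front_prob p n S * of_bool (S = {})) = 1 - reach_prob p n"
        by (simp add: of_bool_def if_distrib sum.delta front_prob_empty cong: if_cong)
      also have "(\<Sum>S\<in>fronts n. front_prob p n S * card S) = mean_front p n"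
        by (simp add: mean_front_def)
      finally have lin: "(1 - d) * (1 - reach_prob p n) + d * (1 - mean_front p n / M) \<le>
          1 - reach_prob p (Suc n)"
        using sum_mono[of "fronts n" "\<lambda>S. front_prob p n S * ((1 - d) * of_bool (S = {}) + d * (1 - card S / M))"
            "\<lambda>S. front_prob p n S * (1 - p) ^ card S"] pt front_prob_nonneg
          dying_bound[of p n] p by (simp add: sum_front_prob mult_left_mono)
      have "mean_front p n / M \<le> \<theta> / 2"
      proof -
        have "2 < M * (p * \<theta>)" using M pM by (simp add: pos_divide_less_eq)
        then have "p * (2 * mean_front p n) \<le> p * (M * \<theta>)" using mean[of n] by (simp add: algebra_simps)
        then have "2 * mean_front p n \<le> M * \<theta>" using p by simp
        then show ?thesis using pM by (simp add: field_simps)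
      qed
      then have "d * (1 - reach_prob p n) + d * \<theta> / 2 \<le> d * (1 - mean_front p n / M)"
        using \<theta>(2)[of n] d mult_left_mono[of "1 - reach_prob p n + \<theta> / 2" "1 - mean_front p n / M" d]
        by (simp add: algebra_simps)
      then show ?thesis using lin by (simp add: algebra_simps)
    qed
    have "reach_prob p n \<le> 1 - n * (d * \<theta> / 2)" for n
    proof (induction n)
      case (Suc n)
      then show ?case using step[of n] by (simp add: algebra_simps add_divide_distrib)
    qed (simp add: reach_prob_bounds)
    note decay = this
    have "0 < d * \<theta> / 2" using d \<theta> by simp
    then obtain n :: nat where "1 < n * (d * \<theta> / 2)"
      using reals_Archimedean3 by blast
    then show False using decay[of n] reach_prob_bounds(1)[of p n] by linarith
  qed
qed

section \<open>A large mean front forces percolation\<close>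

lemma continuous_mean_front: "continuous_on {0..1} (\<lambda>p. p * mean_front p n)"
proof -
  have "continuous_on {0..1} (\<lambda>p. front_prob p n S)" for S
  proof -
    let ?K = "edges (induced_subgraph LG (block n))"
    have "continuous_on {0..1} (\<lambda>p :: real. \<Sum>\<eta>\<in>{\<eta> \<in> ?K \<rightarrow>\<^sub>E UNIV. front n \<eta> = S}.
        \<Prod>e\<in>?K. if \<eta> e then p else 1 - p)"
    proof (intro continuous_on_sum continuous_on_prod)
      show "continuous_on {0..1} (\<lambda>p :: real. if \<eta> e then p else 1 - p)"
        for \<eta> :: "(int \<times> int set) set \<Rightarrow> bool" and e
        by (cases "\<eta> e") (auto intro!: continuous_intros)
    qed
    then show ?thesis
      unfolding front_prob_def
      by (subst continuous_on_cong[OF refl perc_prob_finite_support[OF finite_block_edges block_edges_subset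
              depends_on_comp[OF depends_on_front]]]) auto
  qed
  then show ?thesis unfolding mean_front_def by (intro continuous_intros)
qed

lemma smaller_parameter:
  assumes q: "0 < q" "q \<le> 1" and m: "1 < q * mean_front q n"
  shows "\<exists>p. 0 \<le> p \<and> p < q \<and> 1 < p * mean_front p n"
proof -
  let ?h = "\<lambda>p. p * mean_front p n"
  obtain \<delta> where \<delta>: "\<delta> > 0" "\<And>x. x \<in> {0..1} \<Longrightarrow> dist x q < \<delta> \<Longrightarrow> dist (?h x) (?h q) < ?h q - 1"
    using continuous_mean_front[of n] q m unfolding continuous_on_iff
    by (metis (no_types, lifting) atLeastAtMost_iff diff_gt_0_iff_gt less_imp_le)
  define x where "x = max 0 (q - \<delta> / 2)"
  have x: "0 \<le> x" "x < q" "dist x q < \<delta>" using \<delta>(1) q by (auto simp: x_def dist_real_def max_def)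
  then have "dist (?h x) (?h q) < ?h q - 1" using q by (intro \<delta>(2)) auto
  then have "1 < ?h x" by (simp add: dist_real_def abs_less_iff)
  then show ?thesis using x by blast
qed

text \<open>
  The survival of a supercritical branching process: the function \<open>u \<mapsto> 1 - g u\<close>, where \<open>g\<close> is
  the bound of \<open>branching_bound\<close>, has derivative greater than 1 at the fixed point 0, so it maps
  some interval \<open>{\<epsilon>..1}\<close> with \<open>\<epsilon> > 0\<close> into \<open>{\<epsilon>..}\<close>.
\<close>

lemma reach_prob_bounded_below:
  assumes p: "0 \<le> p" "p \<le> 1" and mean: "1 < p * mean_front p n"
  shows "\<exists>\<epsilon>>0. \<forall>m. \<epsilon> \<le> reach_prob p m"
proof -
  define g where "g u = (\<Sum>S\<in>fronts n. front_prob p n S * (1 - p * u) ^ card S)" for u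
  have g0: "g 0 = 1" by (simp add: g_def sum_front_prob)
  have "((\<lambda>u. 1 - g u - u) has_real_derivative (p * mean_front p n - 1)) (at 0)"
    unfolding g_def mean_front_def
    by (auto intro!: derivative_eq_intros simp: sum_distrib_left algebra_simps simp flip: sum_negf)
  from DERIV_pos_inc_right[OF this] obtain d where d: "0 < d"
    "\<And>h. 0 < h \<Longrightarrow> h < d \<Longrightarrow> 1 - g 0 - 0 < 1 - g (0 + h) - (0 + h)"
    using mean by auto
  have d': "0 < 1 - g h - h" if "0 < h" "h < d" for h
    using d(2)[OF that] g0 by simp
  define \<epsilon> where "\<epsilon> = min 1 (d / 2)"
  have \<epsilon>: "0 < \<epsilon>" "\<epsilon> \<le> 1" "\<epsilon> \<le> 1 - g \<epsilon>"
    using d(1) d'[of \<epsilon>] by (auto simp: \<epsilon>_def min_def split: if_splits)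
  have "\<epsilon> \<le> reach_prob p (k * Suc n)" for k
  proof (induction k)
    case 0
    show ?case using \<epsilon>(2) by (simp add: reach_prob_0)
  next
    case (Suc k)
    let ?u = "reach_prob p (k * Suc n)"
    have "g ?u \<le> g \<epsilon>"
      unfolding g_def
    proof (intro sum_mono mult_left_mono power_mono front_prob_nonneg)
      show "1 - p * ?u \<le> 1 - p * \<epsilon>" using Suc p by (simp add: mult_left_mono)
      show "0 \<le> 1 - p * ?u" using p reach_prob_bounds[of p "k * Suc n"] by (simp add: mult_le_one)
    qed
    moreover have "1 - reach_prob p (Suc k * Suc n) \<le> g ?u"
      using branching_bound[OF p, of n "k * Suc n"] unfolding g_def mult_Suc .
    ultimately show ?case using \<epsilon>(3) by linarith
  qed
  moreover have "reach_prob p (m * Suc n) \<le> reach_prob p m" for m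
    by (rule reach_prob_antimono) simp
  ultimately show ?thesis using \<epsilon>(1) by (meson order_trans)
qed

lemma infinite_cluster_origin_prob:
  assumes "\<And>m. \<epsilon> \<le> reach_prob p m"
  shows "\<epsilon> \<le> perc_prob LG p (\<lambda>\<omega>. infinite (cluster LG \<omega> origin))"
proof -
  let ?M = "percolation LG p"
  interpret M: prob_space ?M by (rule prob_space_percolation)
  let ?A = "\<lambda>m. {\<omega> \<in> space ?M. reaches m \<omega>}"
  have "(\<lambda>m. M.prob (?A m)) \<longlonglongrightarrow> M.prob (\<Inter>m. ?A m)"
  proof (rule M.finite_Lim_measure_decseq)
    show "range ?A \<subseteq> M.events" using pred_reaches by (auto simp: pred_def)
    show "decseq ?A" by (auto simp: decseq_def intro: reaches_antimono)
  qed
  moreover have "(\<Inter>m. ?A m) = {\<omega> \<in> space ?M. infinite (cluster LG \<omega> origin)}"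
    by (auto simp: infinite_cluster_origin_iff)
  ultimately show ?thesis
    using assms by (intro LIMSEQ_le_const) (auto simp: reach_prob_def)
qed

lemma pred_has_infinite_cluster_LG: "Measurable.pred (percolation LG p) (has_infinite_cluster LG)"
  by (rule pred_has_infinite_cluster[OF countable_verts_LG edges_LG_subset])

text \<open>
  The graph contains two edge-disjoint copies of itself, so the probability \<open>q\<close> of having no
  infinite cluster satisfies \<open>q \<le> q * q\<close>.
\<close>

lemma zero_one_law:
  assumes pos: "0 < perc_prob LG p (has_infinite_cluster LG)"
  shows "perc_prob LG p (has_infinite_cluster LG) = 1"
proof -
  let ?M = "percolation LG p"
  interpret M: prob_space ?M by (rule prob_space_percolation)
  let ?N = "\<lambda>\<omega>. \<not> has_infinite_cluster LG \<omega>"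
  have N: "Measurable.pred ?M ?N" by (rule pred_intros_logic(2)[OF pred_has_infinite_cluster_LG])
  define q where "q = perc_prob LG p ?N"
  have c: "Measurable.pred ?M (\<lambda>\<omega>. ?N (copy 0 F \<omega>))" "perc_prob LG p (\<lambda>\<omega>. ?N (copy 0 F \<omega>)) = q"
    "depends_on (\<lambda>\<omega>. ?N (copy 0 F \<omega>)) (stem_copy 0 F)" if "F \<subseteq> {0..int 0}" for F
  proof -
    show "depends_on (\<lambda>\<omega>. ?N (copy 0 F \<omega>)) (stem_copy 0 F)"
      by (rule depends_on_comp[OF depends_on_mono[OF depends_on_copy]]) (auto simp: stem_copy_def)
  qed (use copy_percolation[OF that N] in \<open>simp_all add: q_def\<close>)
  have F: "{} \<subseteq> {0..int 0}" "{0} \<subseteq> {0..int 0}" by auto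
  have m: "Measurable.pred ?M (\<lambda>\<omega>. ?N (copy 0 {} \<omega>) \<and> ?N (copy 0 {0} \<omega>))"
    by (intro pred_intros_logic(3) c(1) F)
  have "q \<le> perc_prob LG p (\<lambda>\<omega>. ?N (copy 0 {} \<omega>) \<and> ?N (copy 0 {0} \<omega>))"
    unfolding q_def
  proof (rule M.finite_measure_mono)
    show "{\<omega> \<in> space ?M. ?N \<omega>} \<subseteq> {\<omega> \<in> space ?M. ?N (copy 0 {} \<omega>) \<and> ?N (copy 0 {0} \<omega>)}"
      using copy_has_infinite_cluster[OF F(1)] copy_has_infinite_cluster[OF F(2)] by blast
  qed (use m in \<open>simp add: pred_def\<close>)
  also have "\<dots> = q * q"
  proof -
    have "stem_copy 0 {} \<inter> stem_copy 0 {0} = {}"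
      using disjoint_stem_copies[of 0] by (auto simp: disjoint_family_on_def)
    from perc_prob_indep2[OF edges_LG_nonempty stem_copy_subset[OF F(1)] stem_copy_subset[OF F(2)] this
        c(1)[OF F(1)] c(3)[OF F(1)] c(1)[OF F(2)] c(3)[OF F(2)]]
    show ?thesis using c(2)[OF F(1)] c(2)[OF F(2)] by simp
  qed
  finally have "q * (1 - q) \<le> 0" by (simp add: algebra_simps)
  moreover have q: "q = 1 - perc_prob LG p (has_infinite_cluster LG)"
    unfolding q_def by (rule perc_prob_not[OF pred_has_infinite_cluster_LG])
  ultimately have "q \<le> 0" using pos by (simp add: mult_le_0_iff)
  moreover have "0 \<le> q" by (simp add: q_def)
  ultimately show ?thesis using q by linarith
qed

lemma supercritical:
  assumes p: "0 \<le> p" "p \<le> 1" and mean: "1 < p * mean_front p n"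
  shows "perc_prob LG p (has_infinite_cluster LG) = 1"
proof (rule zero_one_law)
  interpret M: prob_space "percolation LG p" by (rule prob_space_percolation)
  obtain \<epsilon> where "0 < \<epsilon>" "\<And>m. \<epsilon> \<le> reach_prob p m"
    using reach_prob_bounded_below[OF assms] by blast
  then have "0 < perc_prob LG p (\<lambda>\<omega>. infinite (cluster LG \<omega> origin))"
    using infinite_cluster_origin_prob by (meson less_le_trans)
  also have "\<dots> \<le> perc_prob LG p (has_infinite_cluster LG)"
    using pred_has_infinite_cluster_LG[of p] origin_in
    by (intro M.finite_measure_mono) (auto simp: pred_def has_infinite_cluster_def)
  finally show "0 < perc_prob LG p (has_infinite_cluster LG)" .
qed

section \<open>Reduction to the cluster of the origin\<close>

text \<open>
  By insertion tolerance along a path from the origin to \<open>v\<close>.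
\<close>

lemma infinite_cluster_at_origin:
  assumes p: "0 < p" "p \<le> 1" and v: "v \<in> verts LG"
    and pos: "0 < perc_prob LG p (\<lambda>\<omega>. infinite (cluster LG \<omega> v))"
  shows "0 < perc_prob LG p (\<lambda>\<omega>. infinite (cluster LG \<omega> origin))"
proof -
  interpret M: prob_space "percolation LG p" by (rule prob_space_percolation)
  have pred: "Measurable.pred (percolation LG p) (\<lambda>\<omega>. infinite (cluster LG \<omega> u))" for u
    by (rule pred_infinite_cluster[OF countable_verts_LG edges_LG_subset])
  from LG_connected[OF v] show ?thesis
    using pos
  proof (induction rule: rtrancl_induct)
    case (step y z)
    then have e: "{y, z} \<in> edges LG" by simp
    have "0 < p * perc_prob LG p (\<lambda>\<omega>. infinite (cluster LG \<omega> z))" using p step.prems by simp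
    also have "\<dots> \<le> perc_prob LG p (\<lambda>\<omega>. \<omega> {y, z} \<and> infinite (cluster LG \<omega> z))"
    proof (rule perc_prob_insert_edge[OF e])
      show "depends_on (\<lambda>\<omega>. infinite (cluster LG \<omega> z)) (edges LG)"
        by (rule depends_on_comp[OF depends_on_cluster])
      show "infinite (cluster LG (fun_upd \<omega> {y, z} True) z)" if "infinite (cluster LG \<omega> z)" for \<omega>
        using that cluster_mono[of LG LG \<omega> "fun_upd \<omega> {y, z} True" z] finite_subset by fastforce
    qed (use p pred in auto)
    also have "\<dots> \<le> perc_prob LG p (\<lambda>\<omega>. infinite (cluster LG \<omega> y))"
    proof (rule M.finite_measure_mono)
      show "{\<omega> \<in> space (percolation LG p). infinite (cluster LG \<omega> y)} \<in> M.events"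
        using pred[of y] by (simp add: pred_def)
      have "cluster LG \<omega> z \<subseteq> cluster LG \<omega> y" if "\<omega> {y, z}" for \<omega>
      proof -
        have "y \<in> verts LG" "z \<in> verts LG" using e edges_LG_subset by auto
        then have "z \<in> cluster LG \<omega> y" using that e by (intro cluster_step[OF cluster_refl])
        then show ?thesis by (auto intro: cluster_trans)
      qed
      then show "{\<omega> \<in> space (percolation LG p). \<omega> {y, z} \<and> infinite (cluster LG \<omega> z)} \<subseteq>
          {\<omega> \<in> space (percolation LG p). infinite (cluster LG \<omega> y)}"
        by (auto dest: finite_subset)
    qed
    finally show ?case by (rule step.IH)
  qed
qed

lemma no_percolation_at_0: "AE \<omega> in percolation LG 0. \<not> has_infinite_cluster LG \<omega>"
proof -
  interpret M: prob_space "percolation LG 0" by (rule prob_space_percolation)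
  have "countable (edges LG)"
  proof (rule countable_subset)
    show "edges LG \<subseteq> {A. finite A \<and> A \<subseteq> verts LG}"
    proof
      fix e assume e: "e \<in> edges LG"
      then have "finite e" by (cases rule: edges_LG_cases) (simp_all add: up_edge_def flip_edge_def)
      then show "e \<in> {A. finite A \<and> A \<subseteq> verts LG}" using e edges_LG_subset by blast
    qed
    show "countable {A. finite A \<and> A \<subseteq> verts LG}"
      using countable_Collect_finite_subset[OF countable_verts_LG] by simp
  qed
  moreover have "AE \<omega> in percolation LG 0. \<not> \<omega> e" if e: "e \<in> edges LG" for e
  proof -
    have "M.prob {\<omega> \<in> space (percolation LG 0). \<omega> e} = 0"
      using perc_prob_edge_open[OF e, of 0] by simp
    moreover have "{\<omega> \<in> space (percolation LG 0). \<omega> e} \<in> M.events"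
      using pred_edge_open[OF e] by (simp add: pred_def)
    ultimately show ?thesis by (subst (asm) M.prob_eq_0) auto
  qed
  ultimately have "AE \<omega> in percolation LG 0. \<forall>e\<in>edges LG. \<not> \<omega> e"
    by (simp add: AE_ball_countable)
  then show ?thesis
  proof (rule AE_mp, intro AE_I2 impI)
    fix \<omega> :: "(int \<times> int set) set \<Rightarrow> bool" assume "\<forall>e\<in>edges LG. \<not> \<omega> e"
    then have "open_edges LG \<omega> = {}" by (auto simp: open_edges_def)
    then have "cluster LG \<omega> v \<subseteq> {v}" for v by (auto simp: cluster_def)
    then show "\<not> has_infinite_cluster LG \<omega>"
      using finite_subset by (fastforce simp: has_infinite_cluster_def)
  qed
qed

section \<open>Absence of percolation at criticality\<close>

text \<open>
  If there is an infinite cluster with positive probability, then at some smaller parameter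
  there is one almost surely.
\<close>

lemma percolation_open:
  assumes q: "0 \<le> q" "q \<le> 1" and inf: "\<not> (AE \<omega> in percolation LG q. \<not> has_infinite_cluster LG \<omega>)"
  shows "\<exists>p. 0 \<le> p \<and> p < q \<and> perc_prob LG p (has_infinite_cluster LG) = 1"
proof -
  interpret M: prob_space "percolation LG q" by (rule prob_space_percolation)
  have q0: "0 < q" using q inf no_percolation_at_0 by (cases "q = 0") auto
  have pred: "Measurable.pred (percolation LG q) (\<lambda>\<omega>. infinite (cluster LG \<omega> v))" for v
    by (rule pred_infinite_cluster[OF countable_verts_LG edges_LG_subset])
  have "\<exists>v\<in>verts LG. \<not> (AE \<omega> in percolation LG q. \<not> infinite (cluster LG \<omega> v))"
    using inf countable_verts_LG by (auto simp: has_infinite_cluster_def AE_ball_countable)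
  then obtain v where v: "v \<in> verts LG" "\<not> (AE \<omega> in percolation LG q. \<not> infinite (cluster LG \<omega> v))"
    by blast
  have "perc_prob LG q (\<lambda>\<omega>. infinite (cluster LG \<omega> v)) \<noteq> 0"
    using v(2) pred[of v] M.prob_eq_0[of "{\<omega> \<in> space (percolation LG q). infinite (cluster LG \<omega> v)}"]
    by (auto simp: pred_def)
  then have "0 < perc_prob LG q (\<lambda>\<omega>. infinite (cluster LG \<omega> v))"
    by (simp add: zero_less_measure_iff)
  then have pos: "0 < perc_prob LG q (\<lambda>\<omega>. infinite (cluster LG \<omega> origin))"
    by (rule infinite_cluster_at_origin[OF q0 q(2) v(1)])
  have "perc_prob LG q (\<lambda>\<omega>. infinite (cluster LG \<omega> origin)) \<le> reach_prob q m" for m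
    unfolding reach_prob_def using pred_reaches[of m q]
    by (intro M.finite_measure_mono) (auto simp: pred_def infinite_cluster_origin_iff)
  from large_front[OF q0 q(2) pos this] obtain n where "1 < q * mean_front q n" ..
  from smaller_parameter[OF q0 q(2) this] obtain p where "0 \<le> p" "p < q" "1 < p * mean_front p n"
    by blast
  then show ?thesis using supercritical[of p n] q by auto
qed

theorem mainTheorem5:
  "AE \<omega> in percolation lamplighter_graph_plus (critical_probability lamplighter_graph_plus).
     \<not> has_infinite_cluster lamplighter_graph_plus \<omega>"
proof (rule ccontr)
  let ?A = "{p. 0 \<le> p \<and> p \<le> 1 \<and> perc_prob LG p (has_infinite_cluster LG) = 1}"
  let ?pc = "critical_probability LG"
  have pc: "?pc = Inf ?A" by (simp add: critical_probability_def)
  have bdd: "bdd_below ?A" by (rule bdd_belowI[of _ 0]) simp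
  have "1 \<in> ?A" using supercritical[of 1 0] mean_front_0_at_1 by simp
  then have "0 \<le> ?pc" "?pc \<le> 1"
    unfolding pc using bdd by (auto intro!: cInf_greatest cInf_lower)
  moreover assume "\<not> ?thesis"
  ultimately obtain p where "0 \<le> p" "p < ?pc" "perc_prob LG p (has_infinite_cluster LG) = 1"
    using percolation_open by blast
  with \<open>?pc \<le> 1\<close> have "p \<in> ?A" by simp
  with bdd have "?pc \<le> p" unfolding pc by (rule cInf_lower[rotated])
  with \<open>p < ?pc\<close> show False by simp
qed

end
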